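(* Let $q\ge 2$, let $F\in\mathcal C^2(\Delta)$ be such that $G$ satisfies (A) and (B), and assume that the matrices $\Sigma^{(1)},\dots,\Sigma^{(p)}$ are positive definite. Let $k=k(N)$ be integers with $1\le k(N)\le N$. If $\lim_{N\to\infty}\frac{k}{N}=\alpha\in(0,1]$, then $$\liminf_{N\to\infty}H\big(\mu_N^{(k)}\,\big|\,\rho^{(k)}\big)>0 .$$
   Context: Gibbs measure: fix an integer $q\ge 2$ and let $\Delta=\{m\in[0,1]^q:\sum_{k=1}^q m_k=1\}$. For $\sigma=(\sigma_i)_{i=1}^N\in\{1,\dots,q\}^N$ let $m_N(\sigma)=\big(\frac1N\sum_{i=1}^N \mathbf 1\{\sigma_i=k\}\big)_{k=1,\dots,q}\in\Delta$. For a fixed function $F\in\mathcal C^2(\Delta)$ the Gibbs measure is the probability measure on $\{1,\dots,q\}^N$ given by $\mu_N(\sigma)=\frac1{Z_N}\exp(NF(m_N(\sigma)))$, with $Z_N=\sum_{\sigma\in\{1,\dots,q\}^N}\exp(NF(m_N(\sigma)))$. For $k\le N$, $\mu_N^{(k)}$ denotes the marginal law of $(\sigma_1,\dots,\sigma_k)$ under $\mu_N$ (by exchangeability the choice of the $k$ coordinates is irrelevant). Free energy: let $\hat\Delta=\{\hat m\in[0,1]^{q-1}:\sum_{k=1}^{q-1}\hat m_k\le 1\}$. A point $\hat m\in\hat\Delta$ is identified with $m=(\hat m,1-\sum_{k=1}^{q-1}\hat m_k)\in\Delta$. Let $\mathrm{ent}(m)=-\sum_{k=1}^q m_k\log m_k$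 (with $0\log 0=0$) and $G(\hat m)=F(m)+\mathrm{ent}(m)$, viewed as a function of the $q-1$ coordinates $\hat m\in\hat\Delta$. Assumptions: (A) $G$ has exactly $p\in\mathbb N$ global maximizers $M_1,\dots,M_p$ on $\hat\Delta$; they are isolated and lie in the interior of $\hat\Delta$. (B) For each $j=1,\dots,p$ the $(q-1)\times(q-1)$ matrix $H_j:=-\mathrm{Hess}_G(M_j)$ is positive definite. Write $M_j=(M_{j,1},\dots,M_{j,q-1})$ and $M_{j,q}=1-\sum_{k=1}^{q-1}M_{j,k}$. Set $w_j=\big(\det(H_j)\prod_{k=1}^q M_{j,k}\big)^{-1/2}$ and $|w|=\sum_{j=1}^p w_j$. Let $\Sigma^{(j)}=H_j^{-1}-\mathrm{diag}(M_j)+M_jM_j^T$, where $M_j$ is the column vector $(M_{j,1},\dots,M_{j,q-1})$ and $\mathrm{diag}(M_j)$ is the diagonal matrix with these entries. Comparison measure: $\rho^{(k)}$ is the convex combination of product measures on $\{1,\dots,q\}^k$ given by $$\rho^{(k)}(\sigma)=\frac1{|w|}\sum_{j=1}^p w_j\prod_{i=1}^k\sum_{l=1}^q M_{j,l}\,\mathbf 1\{\sigma_i=l\}.$$ Relative entropy: $H(\varrho|\pi)=\int\log\frac{d\varrho}{d\pi}\,d\varrho$ if $\varrho\ll\pi$, and $+\infty$ otherwise. *)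

theory Defs
  imports "HOL-Probability.Probability"
begin

(* The q colours are the elements of 'n option, so q = CARD('n) + 1 runs through all integers
   q >= 2.  The colours Some i are the first q - 1 ones and carry the free coordinates;
   None is the colour q. *)

definition prob_simplex :: "(real ^ 'c::finite) set" where
  "prob_simplex = {m. (\<forall>c. 0 \<le> m $ c \<and> m $ c \<le> 1) \<and> (\<Sum>c\<in>UNIV. m $ c) = 1}"

definition red_simplex :: "(real ^ 'n::finite) set" where
  "red_simplex = {x. (\<forall>i. 0 \<le> x $ i \<and> x $ i \<le> 1) \<and> (\<Sum>i\<in>UNIV. x $ i) \<le> 1}"

definition lift :: "real ^ 'n::finite \<Rightarrow> real ^ ('n option)" where
  "lift x = (\<chi> c. case c of Some i \<Rightarrow> x $ i | None \<Rightarrow> 1 - (\<Sum>i\<in>UNIV. x $ i))"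

(* Derivatives are taken within S, so this is C^2 up to the boundary.  For S = prob_simplex, the
   derivatives are determined by f only on directions tangent to S; as f' and f'' are merely
   required to exist, this says the same as C^2 regularity of f o lift on red_simplex. *)
definition C2_on :: "'a::real_normed_vector set \<Rightarrow> ('a \<Rightarrow> real) \<Rightarrow> bool" where
  "C2_on S f \<longleftrightarrow>
     (\<exists>(f' :: 'a \<Rightarrow> 'a \<Rightarrow>\<^sub>L real) (f'' :: 'a \<Rightarrow> 'a \<Rightarrow>\<^sub>L ('a \<Rightarrow>\<^sub>L real)).
        (\<forall>x\<in>S. (f has_derivative blinfun_apply (f' x)) (at x within S)) \<and>
        (\<forall>x\<in>S. (f' has_derivative blinfun_apply (f'' x)) (at x within S)) \<and>
        continuous_on S f'')"

(* ln 0 = 0, hence 0 * ln 0 = 0 as required. *)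
definition ent :: "real ^ 'c::finite \<Rightarrow> real" where
  "ent m = - (\<Sum>c\<in>UNIV. m $ c * ln (m $ c))"

definition free_energy :: "(real ^ ('n::finite option) \<Rightarrow> real) \<Rightarrow> real ^ 'n \<Rightarrow> real" where
  "free_energy F x = F (lift x) + ent (lift x)"

definition partial_deriv :: "'n::finite \<Rightarrow> (real ^ 'n \<Rightarrow> real) \<Rightarrow> real ^ 'n \<Rightarrow> real" where
  "partial_deriv i f x = frechet_derivative f (at x) (axis i 1)"

definition hessian :: "(real ^ 'n::finite \<Rightarrow> real) \<Rightarrow> real ^ 'n \<Rightarrow> real ^ 'n ^ 'n" where
  "hessian f x = (\<chi> i j. partial_deriv i (partial_deriv j f) x)"

definition pos_def :: "real ^ 'n::finite ^ 'n \<Rightarrow> bool" where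
  "pos_def A \<longleftrightarrow> transpose A = A \<and> (\<forall>x. x \<noteq> 0 \<longrightarrow> x \<bullet> (A *v x) > 0)"

definition maximizers :: "(real ^ 'n::finite \<Rightarrow> real) \<Rightarrow> (real ^ 'n) set" where
  "maximizers G = {x \<in> red_simplex. \<forall>y\<in>red_simplex. G y \<le> G x}"

definition assumption_A ::
  "(real ^ ('n::finite option) \<Rightarrow> real) \<Rightarrow> nat \<Rightarrow> (nat \<Rightarrow> real ^ 'n) \<Rightarrow> bool" where
  "assumption_A F p M \<longleftrightarrow>
     bij_betw M {1..p} (maximizers (free_energy F)) \<and>
     (\<forall>j\<in>{1..p}. M j isolated_in maximizers (free_energy F) \<and> M j \<in> interior red_simplex)"

definition H_mat :: "(real ^ ('n::finite option) \<Rightarrow> real) \<Rightarrow> real ^ 'n \<Rightarrow> real ^ 'n ^ 'n" where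
  "H_mat F x = - hessian (free_energy F) x"

definition assumption_B ::
  "(real ^ ('n::finite option) \<Rightarrow> real) \<Rightarrow> nat \<Rightarrow> (nat \<Rightarrow> real ^ 'n) \<Rightarrow> bool" where
  "assumption_B F p M \<longleftrightarrow> (\<forall>j\<in>{1..p}. pos_def (H_mat F (M j)))"

definition Sigma_mat :: "(real ^ ('n::finite option) \<Rightarrow> real) \<Rightarrow> real ^ 'n \<Rightarrow> real ^ 'n ^ 'n" where
  "Sigma_mat F x =
     matrix_inv (H_mat F x) - (\<chi> a b. if a = b then x $ a else 0) + (\<chi> a b. x $ a * x $ b)"

definition configs :: "nat \<Rightarrow> (nat \<Rightarrow> 'c) set" where
  "configs N = ({1..N} \<rightarrow>\<^sub>E UNIV)"

definition emp :: "nat \<Rightarrow> (nat \<Rightarrow> 'c::finite) \<Rightarrow> real ^ 'c" where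
  "emp N \<sigma> = (\<chi> c. (\<Sum>i=1..N. of_bool (\<sigma> i = c)) / real N)"

definition partition_fun :: "(real ^ 'c::finite \<Rightarrow> real) \<Rightarrow> nat \<Rightarrow> real" where
  "partition_fun F N = (\<Sum>\<sigma>\<in>configs N. exp (real N * F (emp N \<sigma>)))"

definition gibbs :: "(real ^ 'c::finite \<Rightarrow> real) \<Rightarrow> nat \<Rightarrow> (nat \<Rightarrow> 'c) measure" where
  "gibbs F N =
     point_measure (configs N) (\<lambda>\<sigma>. ennreal (exp (real N * F (emp N \<sigma>)) / partition_fun F N))"

definition gibbs_marginal ::
  "(real ^ 'c::finite \<Rightarrow> real) \<Rightarrow> nat \<Rightarrow> nat \<Rightarrow> (nat \<Rightarrow> 'c) measure" where
  "gibbs_marginal F N k = distr (gibbs F N) (count_space (configs k)) (\<lambda>\<sigma>. restrict \<sigma> {1..k})"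

definition weight :: "(real ^ ('n::finite option) \<Rightarrow> real) \<Rightarrow> real ^ 'n \<Rightarrow> real" where
  "weight F x = (det (H_mat F x) * (\<Prod>c\<in>UNIV. lift x $ c)) powr (- 1 / 2)"

definition rho ::
  "(real ^ ('n::finite option) \<Rightarrow> real) \<Rightarrow> nat \<Rightarrow> (nat \<Rightarrow> real ^ 'n) \<Rightarrow> nat
     \<Rightarrow> (nat \<Rightarrow> 'n option) measure" where
  "rho F p M k =
     point_measure (configs k) (\<lambda>\<sigma>. ennreal
       (1 / (\<Sum>j=1..p. weight F (M j)) *
        (\<Sum>j=1..p. weight F (M j) *
           (\<Prod>i=1..k. \<Sum>l\<in>UNIV. lift (M j) $ l * of_bool (\<sigma> i = l)))))"

(* absolutely_continuous P R means R << P, and KL_divergence takes the reference measure first.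
   For probability measures R << P the negative part of log (dR/dP) is always R-integrable, so
   failure of integrability means that the integral is +infinity, whereas KL_divergence would
   then be 0. *)
definition rel_entropy :: "'a measure \<Rightarrow> 'a measure \<Rightarrow> ereal" where
  "rel_entropy R P =
     (if absolutely_continuous P R \<and> integrable R (entropy_density (exp 1) P R)
      then ereal (KL_divergence (exp 1) P R) else \<infinity>)"

end

theory Submission
  imports Defs
begin

text \<open>
  Let \<open>g\<close> be the maximum of the free energy, \<open>v\<close> one of the maximizers (in all \<open>q\<close> coordinates) and
  \<open>P\<close> the law of independent colours with distribution \<open>v\<close>.  Relative to \<open>P\<close> the Gibbs measure has
  the density \<open>exp (N \<Phi>) / Z\<close> with \<open>\<Phi> m = F m - (\<Sum>c. m c * ln (v c))\<close>, evaluated at the empirical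
  measure, and positive definiteness of \<open>\<Sigma>\<close> means that \<open>\<Phi>\<close> has a nondegenerate local minimum, of
  value \<open>g\<close>, at \<open>v\<close>.  On the other hand \<open>Z \<le> C exp (N g)\<close>.  Hence, if the empirical measure of the
  first \<open>k\<close> colours deviates from \<open>v\<close> by about \<open>s / sqrt k\<close> with \<open>s\<close> large but fixed, the marginal
  of the Gibbs measure is at least twice \<open>P\<close>, because \<open>k / N\<close> is bounded below; near \<open>v\<close> the
  mixture \<open>\<rho>\<close> is at most \<open>P\<close>.  Such deviations have probability bounded below under \<open>P\<close>, hence
  under \<open>\<rho>\<close>, and the relative entropy is at least \<open>2 ln 2 - 1\<close> times the \<open>\<rho>\<close>-probability of a set
  on which the density is at least 2.
\<close>

section \<open>Product measures and their typical configurations\<close>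

text \<open>The scale shapes the proof. At distance of order 1 / sqrt N from v the strict minimum
  gains only a constant factor exp K, which has to beat the normalisation. Counting empirical
  measures bounds Z up to a power of N, too much for any fixed s; hence a Gaussian sum over a
  lattice near the maximizers, while crude counting serves where the free energy stays below g by a
  fixed amount. The N - k remaining colours also fluctuate by sqrt N and could cancel the
  displacement of the first k; with k / N bounded below, a large s prevents this.

  The minimum arises from \<Phi> = (F + ent) + KL(. | v). Along a tangent vector h the first term
  loses half the form of H at h, and the second gains half the Fisher form Q, the sum of the squares
  of the components of h divided by those of v. In the free coordinates diag x - x x^T is the
  inverse of Q, so \<Sigma> = H^-1 - Q^-1, and positivity of \<Sigma> gives H < Q.

  The constant 2 ln 2 - 1 is the value at 2 of the nonnegative function x ln x - x + 1.\<close>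

definition counts :: "nat \<Rightarrow> (nat \<Rightarrow> 'c::finite) \<Rightarrow> real ^ 'c" where
  "counts k \<sigma> = (\<chi> c. \<Sum>i=1..k. of_bool (\<sigma> i = c))"

definition prodw :: "nat \<Rightarrow> real ^ 'c::finite \<Rightarrow> (nat \<Rightarrow> 'c) \<Rightarrow> real" where
  "prodw k v \<sigma> = (\<Prod>i=1..k. v $ \<sigma> i)"

lemma finite_configs [simp]: "finite (configs k :: (nat \<Rightarrow> 'c::finite) set)"
  by (simp add: configs_def finite_PiE)

lemma emp_eq_counts: "emp N \<sigma> = counts N \<sigma> /\<^sub>R real N"
  by (simp add: emp_def counts_def vec_eq_iff divide_inverse mult.commute)

lemma counts_eq_emp: "counts N \<sigma> = real N *\<^sub>R emp N \<sigma>"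
  by (cases "N = 0") (simp_all add: emp_eq_counts, simp add: counts_def vec_eq_iff)

lemma sum_prodw: "(\<Sum>\<sigma>\<in>configs k. prodw k v \<sigma>) = (\<Sum>c\<in>UNIV. v $ c) ^ k"
  using prod_sum_PiE[of "{1..k}" "\<lambda>_. UNIV" "\<lambda>_ c. v $ c"]
  by (simp add: configs_def prodw_def)

lemma sum_counts: "(\<Sum>c\<in>UNIV. counts k \<sigma> $ c * f c) = (\<Sum>i=1..k. f (\<sigma> i))"
proof -
  have "(\<Sum>c\<in>UNIV. counts k \<sigma> $ c * f c) = (\<Sum>c\<in>UNIV. \<Sum>i=1..k. of_bool (\<sigma> i = c) * f c)"
    by (simp add: counts_def sum_distrib_right)
  also have "\<dots> = (\<Sum>i=1..k. \<Sum>c\<in>UNIV. of_bool (\<sigma> i = c) * f c)"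
    by (rule sum.swap)
  also have "\<dots> = (\<Sum>i=1..k. f (\<sigma> i))"
    by (intro sum.cong refl) (simp add: of_bool_def if_distrib if_distribR cong: if_cong)
  finally show ?thesis .
qed

lemma sum_counts_total: "(\<Sum>c\<in>UNIV. counts k \<sigma> $ c) = real k"
  using sum_counts[of k \<sigma> "\<lambda>_. 1"] by simp

lemma counts_nonneg: "0 \<le> counts k \<sigma> $ c"
  by (simp add: counts_def sum_nonneg)

lemma prodw_eq_exp:
  assumes "\<And>c. v $ c > 0"
  shows "prodw k v \<sigma> = exp (\<Sum>c\<in>UNIV. counts k \<sigma> $ c * ln (v $ c))"
  using assms by (simp add: sum_counts prodw_def exp_sum less_imp_neq[symmetric])

lemma emp_in_simplex:
  assumes "N \<ge> 1" shows "emp N \<sigma> \<in> prob_simplex"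
proof -
  have s: "(\<Sum>c\<in>UNIV. emp N \<sigma> $ c) = 1"
    using assms sum_counts_total[of N \<sigma>] by (simp add: emp_eq_counts flip: sum_distrib_left)
  have n: "0 \<le> emp N \<sigma> $ c" for c
    by (simp add: emp_eq_counts counts_nonneg)
  have "emp N \<sigma> $ c \<le> 1" for c
    using member_le_sum[of c UNIV "\<lambda>c. emp N \<sigma> $ c"] n s by simp
  with n s show ?thesis by (simp add: prob_simplex_def)
qed

section \<open>Second moments and typical configurations\<close>

lemma sum_configs_Suc:
  fixes f :: "(nat \<Rightarrow> 'c::finite) \<Rightarrow> real"
  shows "(\<Sum>\<sigma>\<in>configs (Suc k). f \<sigma>) = (\<Sum>\<sigma>\<in>configs k. \<Sum>x\<in>UNIV. f (\<sigma>(Suc k := x)))"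
proof -
  have eq: "configs (Suc k) = (\<lambda>(y, g). g(Suc k := y)) ` (UNIV \<times> (configs k :: (nat \<Rightarrow> 'c) set))"
    using PiE_insert_eq[of "Suc k" "{1..k}" "\<lambda>_. UNIV"]
    by (simp add: configs_def atLeastAtMostSuc_conv)
  have inj: "inj_on (\<lambda>(y, g). g(Suc k := y)) (UNIV \<times> (configs k :: (nat \<Rightarrow> 'c) set))"
    unfolding configs_def by (rule inj_combinator) simp
  show ?thesis
    unfolding eq sum.reindex[OF inj]
    by (subst sum.swap) (simp add: sum.cartesian_product case_prod_unfold)
qed

lemma prodw_Suc: "prodw (Suc k) v (\<sigma>(Suc k := x)) = prodw k v \<sigma> * v $ x"
  by (simp add: prodw_def)

text \<open>Centred independent summands are uncorrelated: when a site is added, the cross term is a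
  multiple of the mean of \<open>g\<close>, which is 0.\<close>

lemma prodw_second_moment:
  assumes "(\<Sum>c\<in>UNIV. v $ c) = 1" "(\<Sum>c\<in>UNIV. v $ c * g c) = 0"
  shows "(\<Sum>\<sigma>\<in>configs k. prodw k v \<sigma> * (\<Sum>i=1..k. g (\<sigma> i))\<^sup>2)
    = real k * (\<Sum>c\<in>UNIV. v $ c * (g c)\<^sup>2)"
proof (induction k)
  case (Suc k)
  have "(\<Sum>x\<in>UNIV. prodw (Suc k) v (\<sigma>(Suc k := x)) * (\<Sum>i=1..Suc k. g ((\<sigma>(Suc k := x)) i))\<^sup>2)
      = prodw k v \<sigma> * (\<Sum>i=1..k. g (\<sigma> i))\<^sup>2 + prodw k v \<sigma> * (\<Sum>c\<in>UNIV. v $ c * (g c)\<^sup>2)" for \<sigma>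
  proof -
    have "(\<Sum>x\<in>UNIV. prodw (Suc k) v (\<sigma>(Suc k := x)) * (\<Sum>i=1..Suc k. g ((\<sigma>(Suc k := x)) i))\<^sup>2)
      = (\<Sum>x\<in>UNIV. prodw k v \<sigma> * (\<Sum>i=1..k. g (\<sigma> i))\<^sup>2 * v $ x
          + 2 * prodw k v \<sigma> * (\<Sum>i=1..k. g (\<sigma> i)) * (v $ x * g x)
          + prodw k v \<sigma> * (v $ x * (g x)\<^sup>2))"
      unfolding prodw_Suc by (rule sum.cong[OF refl], simp add: algebra_simps power2_eq_square)
    also have "\<dots> = prodw k v \<sigma> * (\<Sum>i=1..k. g (\<sigma> i))\<^sup>2 + prodw k v \<sigma> * (\<Sum>c\<in>UNIV. v $ c * (g c)\<^sup>2)"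
      unfolding sum.distrib sum_distrib_left[symmetric] by (simp only: assms mult_1_right mult_zero_right add_0_right)
    finally show ?thesis .
  qed
  then show ?case unfolding sum_configs_Suc using Suc
    by (simp add: sum.distrib sum_distrib_right[symmetric] sum_prodw assms algebra_simps)
qed simp

lemma norm_vec_square: "(norm (x :: real ^ 'c::finite))\<^sup>2 = (\<Sum>c\<in>UNIV. (x $ c)\<^sup>2)"
  by (simp add: norm_vec_def L2_set_def sum_nonneg)

text \<open>The left side is \<open>k\<close> times the sum of \<open>v $ c * (1 - v $ c)\<close>,
  the trace of the multinomial covariance. The bound is uniform in \<open>v\<close>, which allows
  parameters that move with \<open>k\<close>.\<close>

lemma prodw_variance:
  assumes v: "v \<in> prob_simplex"
  shows "(\<Sum>\<sigma>\<in>configs k. prodw k v \<sigma> * (norm (counts k \<sigma> - real k *\<^sub>R v))\<^sup>2) \<le> real k"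
proof -
  have s: "(\<Sum>c\<in>UNIV. v $ c) = 1" and n: "\<And>c. 0 \<le> v $ c" using v by (auto simp: prob_simplex_def)
  define g where "g c x = of_bool (x = c) - v $ c" for c x
  have bs: "(\<Sum>x\<in>UNIV. v $ x * of_bool (x = c)) = v $ c" for c
    by (simp add: of_bool_def if_distrib cong: if_cong)
  have g0: "(\<Sum>x\<in>UNIV. v $ x * g c x) = 0" for c
    by (simp add: g_def right_diff_distrib sum_subtractf bs s flip: sum_distrib_right)
  have g2: "(\<Sum>x\<in>UNIV. v $ x * (g c x)\<^sup>2) \<le> v $ c" for c
  proof -
    have "(\<Sum>x\<in>UNIV. v $ x * (g c x)\<^sup>2)
        = (\<Sum>x\<in>UNIV. v $ x * of_bool (x = c) * (1 - 2 * v $ c) + v $ x * (v $ c)\<^sup>2)"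
      by (rule sum.cong[OF refl], simp add: g_def power2_eq_square algebra_simps)
    also have "\<dots> = v $ c * (1 - 2 * v $ c) + (v $ c)\<^sup>2"
      by (simp only: sum.distrib sum_distrib_right[symmetric] bs s mult_1_left)
    also have "\<dots> \<le> v $ c" by (simp add: power2_eq_square algebra_simps)
    finally show ?thesis .
  qed
  have "(\<Sum>\<sigma>\<in>configs k. prodw k v \<sigma> * (norm (counts k \<sigma> - real k *\<^sub>R v))\<^sup>2)
     = (\<Sum>\<sigma>\<in>configs k. \<Sum>c\<in>UNIV. prodw k v \<sigma> * (\<Sum>i=1..k. g c (\<sigma> i))\<^sup>2)"
    by (simp add: norm_vec_square sum_distrib_left g_def counts_def sum_subtractf)
  also have "\<dots> = (\<Sum>c\<in>UNIV. real k * (\<Sum>x\<in>UNIV. v $ x * (g c x)\<^sup>2))"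
    by (subst sum.swap) (simp only: prodw_second_moment[OF s g0])
  also have "\<dots> \<le> (\<Sum>c\<in>UNIV. real k * v $ c)"
    by (intro sum_mono mult_left_mono g2) auto
  also have "\<dots> = real k" by (simp add: s flip: sum_distrib_left)
  finally show ?thesis .
qed

lemma prodw_nonneg: "v \<in> prob_simplex \<Longrightarrow> 0 \<le> prodw k v \<sigma>"
  by (simp add: prodw_def prob_simplex_def prod_nonneg)

lemma prodw_total: "v \<in> prob_simplex \<Longrightarrow> (\<Sum>\<sigma>\<in>configs k. prodw k v \<sigma>) = 1"
  by (simp add: sum_prodw prob_simplex_def)

text \<open>The squared radius is twice the variance bound of \<open>prodw_variance\<close>, so
  Chebyshev's inequality leaves at least half of the mass, for every \<open>v\<close> in the simplex
  and every \<open>k\<close>.\<close>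

definition typical :: "nat \<Rightarrow> real ^ 'c::finite \<Rightarrow> (nat \<Rightarrow> 'c) set" where
  "typical k v = {\<sigma> \<in> configs k. (norm (counts k \<sigma> - real k *\<^sub>R v))\<^sup>2 \<le> 2 * real k}"

lemma typical_subset: "typical k v \<subseteq> configs k"
  by (auto simp: typical_def)

lemma typical_weight:
  assumes v: "v \<in> prob_simplex"
  shows "1 / 2 \<le> (\<Sum>\<sigma>\<in>typical k v. prodw k v \<sigma>)"
\<comment> \<open>An empty block does occur: the sites that remain after the first \<open>k\<close>
  are none when \<open>k = N\<close>.\<close>
proof (cases "k = 0")
  case True
  then have "typical k v = configs k" by (auto simp: typical_def counts_def norm_vec_square)
  with prodw_total[OF v, of k] show ?thesis by simp
next
  case False
  have "2 * real k * (\<Sum>\<sigma>\<in>configs k - typical k v. prodw k v \<sigma>)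
      \<le> (\<Sum>\<sigma>\<in>configs k - typical k v. prodw k v \<sigma> * (norm (counts k \<sigma> - real k *\<^sub>R v))\<^sup>2)"
    unfolding sum_distrib_left
    by (intro sum_mono) (auto simp: typical_def mult.commute intro!: mult_left_mono prodw_nonneg[OF v])
  also have "\<dots> \<le> (\<Sum>\<sigma>\<in>configs k. prodw k v \<sigma> * (norm (counts k \<sigma> - real k *\<^sub>R v))\<^sup>2)"
    by (intro sum_mono2) (auto intro: mult_nonneg_nonneg prodw_nonneg[OF v])
  also have "\<dots> \<le> real k" by (rule prodw_variance[OF v])
  finally have "(\<Sum>\<sigma>\<in>configs k - typical k v. prodw k v \<sigma>) \<le> 1 / 2"
    using False by (simp add: field_simps)
  moreover have "(\<Sum>\<sigma>\<in>configs k - typical k v. prodw k v \<sigma>) = 1 - (\<Sum>\<sigma>\<in>typical k v. prodw k v \<sigma>)"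
    using prodw_total[OF v] by (simp add: sum_diff typical_subset)
  ultimately show ?thesis by simp
qed

lemma prob_simplexI:
  assumes "\<And>c. 0 \<le> m $ c" "(\<Sum>c\<in>UNIV. m $ c) = 1"
  shows "m \<in> prob_simplex"
proof -
  have "m $ c \<le> 1" for c
    using member_le_sum[of c UNIV "\<lambda>c. m $ c"] assms by simp
  with assms show ?thesis by (simp add: prob_simplex_def)
qed

text \<open>Change of measure: under the product measure of the shifted vector the event is likely, and
  on it the density of the original product measure is bounded below, as the shift has order
  \<open>1 / sqrt k\<close>.\<close>

lemma typical_shifted_weight:
  fixes v d :: "real ^ 'c::finite"
  assumes v: "v \<in> prob_simplex" and pos: "\<And>c. 0 < v $ c" and d: "(\<Sum>c\<in>UNIV. d $ c) = 0"
  shows "\<exists>\<kappa>>0. \<forall>\<^sub>F k in sequentially.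
    \<kappa> \<le> (\<Sum>\<sigma>\<in>typical k (v + (1 / sqrt (real k)) *\<^sub>R d). prodw k v \<sigma>)"
proof -
  define D where "D = (\<Sum>c\<in>UNIV. \<bar>d $ c\<bar> / v $ c)"
  \<comment> \<open>Bound for the logarithm of the density: a deviation of the counts from their
    mean under \<open>v\<close> of at most \<open>sqrt k * (sqrt 2 + norm d)\<close> is paired with
    a tilt of size \<open>1 / sqrt k\<close>, whose direction \<open>D\<close> measures relative to
    \<open>v\<close>.\<close>
  define B where "B = (sqrt 2 + norm d) * D"
  have D0: "0 \<le> D" unfolding D_def using pos by (intro sum_nonneg) (simp add: less_imp_le)
  have s: "(\<Sum>c\<in>UNIV. v $ c) = 1" using v by (simp add: prob_simplex_def)
  have "\<forall>\<^sub>F k in sequentially. \<forall>c. 0 < v $ c + 1 / sqrt (real k) * d $ c"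
  proof (rule eventually_all_finite)
    fix c
    have "(\<lambda>k. v $ c + 1 / sqrt (real k) * d $ c) \<longlonglongrightarrow> v $ c + 0 * d $ c"
      by (intro tendsto_intros) real_asymp
    from order_tendstoD(1)[OF this, of 0] pos[of c]
    show "\<forall>\<^sub>F k in sequentially. 0 < v $ c + 1 / sqrt (real k) * d $ c" by simp
  qed
  then have "\<forall>\<^sub>F k in sequentially.
    exp (- B) / 2 \<le> (\<Sum>\<sigma>\<in>typical k (v + (1 / sqrt (real k)) *\<^sub>R d). prodw k v \<sigma>)"
    using eventually_gt_at_top[of 0]
  proof eventually_elim
    case (elim k)
    define t where "t = 1 / sqrt (real k)"
    define v' where "v' = v + t *\<^sub>R d"
    have t: "0 < t" "real k * t = sqrt (real k)" using elim by (auto simp: t_def real_div_sqrt)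
    have tk: "t * sqrt (real k) = 1" using elim by (simp add: t_def)
    have pos': "0 < v' $ c" for c using elim by (simp add: v'_def t_def)
    have v': "v' \<in> prob_simplex"
      using pos' d s by (intro prob_simplexI) (auto simp: v'_def sum.distrib less_imp_le simp flip: sum_distrib_left)
    have key: "prodw k v' \<sigma> * exp (- B) \<le> prodw k v \<sigma>" if \<sigma>: "\<sigma> \<in> typical k v'" for \<sigma>
    proof -
      have "(norm (counts k \<sigma> - real k *\<^sub>R v'))\<^sup>2 \<le> 2 * real k" using \<sigma> by (simp add: typical_def)
      then have "norm (counts k \<sigma> - real k *\<^sub>R v') \<le> sqrt (2 * real k)" by (rule real_le_rsqrt)
      moreover have "counts k \<sigma> - real k *\<^sub>R v = (counts k \<sigma> - real k *\<^sub>R v') + (real k * t) *\<^sub>R d"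
        by (simp add: v'_def algebra_simps)
      ultimately have "norm (counts k \<sigma> - real k *\<^sub>R v) \<le> sqrt (2 * real k) + norm ((real k * t) *\<^sub>R d)"
        by (metis norm_triangle_le add_mono order_refl)
      also have "\<dots> = sqrt (real k) * (sqrt 2 + norm d)"
        unfolding t(2) by (simp add: real_sqrt_mult distrib_left mult.commute)
      finally have nrm: "norm (counts k \<sigma> - real k *\<^sub>R v) \<le> sqrt (real k) * (sqrt 2 + norm d)" .
      have "(\<Sum>c\<in>UNIV. counts k \<sigma> $ c * ln (v' $ c)) - (\<Sum>c\<in>UNIV. counts k \<sigma> $ c * ln (v $ c))
          = (\<Sum>c\<in>UNIV. counts k \<sigma> $ c * ln (v' $ c / v $ c))"
        using pos pos' by (simp add: ln_div less_imp_neq[symmetric] algebra_simps flip: sum_subtractf)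
      also have "\<dots> \<le> (\<Sum>c\<in>UNIV. counts k \<sigma> $ c * (t * d $ c / v $ c))"
      proof (intro sum_mono mult_left_mono counts_nonneg)
        fix c
        have "ln (v' $ c / v $ c) \<le> v' $ c / v $ c - 1"
          using pos[of c] pos'[of c] by (intro ln_le_minus_one) auto
        also have "\<dots> = t * d $ c / v $ c" using pos[of c] by (simp add: v'_def field_simps)
        finally show "ln (v' $ c / v $ c) \<le> t * d $ c / v $ c" .
      qed
      \<comment> \<open>The counts are split into mean and fluctuation. The mean would give order
        sqrt k, but it contributes \<open>t * real k\<close> times the total of \<open>d\<close>,
        which is 0.\<close>
      also have "\<dots> = (\<Sum>c\<in>UNIV. t * ((counts k \<sigma> $ c - real k * v $ c) * (d $ c / v $ c)) + t * real k * d $ c)"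
        using pos by (intro sum.cong refl) (simp add: field_simps less_imp_neq[symmetric])
      also have "\<dots> = t * (\<Sum>c\<in>UNIV. (counts k \<sigma> $ c - real k * v $ c) * (d $ c / v $ c))"
        by (simp only: sum.distrib sum_distrib_left[symmetric] d mult_zero_right add_0_right)
      also have "\<dots> \<le> t * (\<Sum>c\<in>UNIV. norm (counts k \<sigma> - real k *\<^sub>R v) * (\<bar>d $ c\<bar> / v $ c))"
      proof (intro mult_left_mono sum_mono)
        fix c
        have "(counts k \<sigma> $ c - real k * v $ c) * (d $ c / v $ c)
            \<le> \<bar>(counts k \<sigma> - real k *\<^sub>R v) $ c\<bar> * (\<bar>d $ c\<bar> / v $ c)"
          using abs_ge_self[of "(counts k \<sigma> $ c - real k * v $ c) * (d $ c / v $ c)"] pos[of c]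
          by (simp add: abs_mult)
        also have "\<dots> \<le> norm (counts k \<sigma> - real k *\<^sub>R v) * (\<bar>d $ c\<bar> / v $ c)"
          using pos[of c] by (intro mult_right_mono component_le_norm_cart) auto
        finally show "(counts k \<sigma> $ c - real k * v $ c) * (d $ c / v $ c)
            \<le> norm (counts k \<sigma> - real k *\<^sub>R v) * (\<bar>d $ c\<bar> / v $ c)" .
      qed (use t in auto)
      also have "\<dots> = t * norm (counts k \<sigma> - real k *\<^sub>R v) * D"
        by (simp add: D_def sum_distrib_left mult_ac)
      also have "\<dots> \<le> t * (sqrt (real k) * (sqrt 2 + norm d)) * D"
        using nrm t D0 by (intro mult_right_mono mult_left_mono) auto
      also have "\<dots> = (t * sqrt (real k)) * B" by (simp add: B_def mult_ac)
      also have "\<dots> = B" by (simp add: tk)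
      finally show ?thesis
        using pos pos' by (simp add: prodw_eq_exp flip: exp_add)
    qed
    have "1 / 2 * exp (- B) \<le> (\<Sum>\<sigma>\<in>typical k v'. prodw k v' \<sigma>) * exp (- B)"
      by (intro mult_right_mono typical_weight v') auto
    also have "\<dots> \<le> (\<Sum>\<sigma>\<in>typical k v'. prodw k v \<sigma>)"
      unfolding sum_distrib_right by (intro sum_mono key)
    finally show ?case by (simp add: v'_def t_def)
  qed
  then show ?thesis by (intro exI[of _ "exp (- B) / 2"]) auto
qed

section \<open>Relative entropy of point measures\<close>

lemma xlogx_ge:
  fixes x :: real
  assumes "0 \<le> x"
  shows "x * ln x \<ge> x - 1"
proof (cases "x = 0")
  case False
  with assms have "ln (1 / x) \<le> 1 / x - 1" by (intro ln_le_minus_one) auto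
  with assms False have "x * ln (1 / x) \<le> x * (1 / x - 1)" by (intro mult_left_mono) auto
  with assms False show ?thesis by (simp add: ln_div algebra_simps)
qed simp

text \<open>The derivative of the left side is \<open>ln x\<close>, so it increases beyond 1; the
  right side is its value at 2.\<close>

lemma xlogx_ge_two:
  fixes x :: real
  assumes "2 \<le> x"
  shows "x * ln x - x + 1 \<ge> 2 * ln 2 - 1"
proof -
  have "2 * ln 2 - 2 + 1 \<le> x * ln x - x + 1"
  proof (rule DERIV_nonneg_imp_nondecreasing[OF assms])
    fix t :: real assume "2 \<le> t" "t \<le> x"
    then show "\<exists>y. ((\<lambda>x. x * ln x - x + 1) has_real_derivative y) (at t) \<and> 0 \<le> y"
      by (intro exI[of _ "ln t"] conjI) (use \<open>2 \<le> t\<close> in \<open>auto intro!: derivative_eq_intros simp: field_simps\<close>)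
  qed
  then show ?thesis by simp
qed

text \<open>Both weights have total 1, so adding \<open>f - g\<close> termwise leaves the divergence
  unchanged and turns each term into \<open>f\<close> times \<open>x * ln x - x + 1\<close> at
  \<open>x = g / f\<close>. These terms are nonnegative, hence those outside \<open>E\<close> can be
  discarded.\<close>

lemma rel_entropy_point_measure_ge:
  fixes f g :: "'a \<Rightarrow> real"
  assumes fin: "finite A" and f: "\<And>x. x \<in> A \<Longrightarrow> 0 < f x" and g: "\<And>x. x \<in> A \<Longrightarrow> 0 \<le> g x"
    and sf: "sum f A = 1" and sg: "sum g A = 1"
    and E: "E \<subseteq> A" and gE: "\<And>x. x \<in> E \<Longrightarrow> 2 * f x \<le> g x"
  shows "ereal ((2 * ln 2 - 1) * sum f E)
    \<le> rel_entropy (point_measure A (\<lambda>x. ennreal (g x))) (point_measure A (\<lambda>x. ennreal (f x)))"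
proof -
  interpret sigma_finite_measure "count_space A"
    by (rule sigma_finite_measure_count_space_finite[OF fin])
  have "KL_divergence (exp 1) (point_measure A (\<lambda>x. ennreal (f x))) (point_measure A (\<lambda>x. ennreal (g x)))
      = (\<integral>x. g x * log (exp 1) (g x / f x) \<partial>count_space A)"
    unfolding point_measure_def
  proof (rule KL_density_density)
    show "AE x in count_space A. 0 \<le> f x" "AE x in count_space A. 0 \<le> g x"
      "AE x in count_space A. f x = 0 \<longrightarrow> g x = 0"
      using f g less_irrefl by (fastforce simp: AE_count_space intro: less_imp_le)+
  qed auto
  also have "\<dots> = (\<Sum>x\<in>A. g x * ln (g x / f x))"
    by (simp add: lebesgue_integral_count_space_finite[OF fin] log_def)
  also have "\<dots> = (\<Sum>x\<in>A. f x * (g x / f x * ln (g x / f x) - g x / f x + 1))"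
  proof -
    have "(\<Sum>x\<in>A. f x * (g x / f x * ln (g x / f x) - g x / f x + 1))
        = (\<Sum>x\<in>A. g x * ln (g x / f x) - g x + f x)"
      by (rule sum.cong[OF refl]) (use f in \<open>simp add: field_simps less_imp_neq[symmetric]\<close>)
    then show ?thesis by (simp add: sum.distrib sum_subtractf sf sg)
  qed
  also have "\<dots> \<ge> (\<Sum>x\<in>E. f x * (g x / f x * ln (g x / f x) - g x / f x + 1))"
  proof (rule sum_mono2[OF fin E])
    fix x assume "x \<in> A - E"
    with f[of x] g[of x] have "0 \<le> f x" "0 \<le> g x / f x" by auto
    with xlogx_ge[of "g x / f x"] show "0 \<le> f x * (g x / f x * ln (g x / f x) - g x / f x + 1)"
      by (intro mult_nonneg_nonneg) auto
  qed
  moreover have "(\<Sum>x\<in>E. f x * (g x / f x * ln (g x / f x) - g x / f x + 1)) \<ge> (\<Sum>x\<in>E. f x * (2 * ln 2 - 1))"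
  proof (intro sum_mono mult_left_mono xlogx_ge_two)
    fix x assume "x \<in> E"
    with E f[of x] gE[of x] show "2 \<le> g x / f x" "0 \<le> f x" by (auto simp: field_simps less_imp_le)
  qed
  ultimately have "(\<Sum>x\<in>E. f x * (2 * ln 2 - 1)) \<le> KL_divergence (exp 1)
      (point_measure A (\<lambda>x. ennreal (f x))) (point_measure A (\<lambda>x. ennreal (g x)))"
    by linarith
  \<comment> \<open>If the condition in \<open>rel_entropy\<close> fails, the value is infinity and
    the bound is trivial; otherwise it is the divergence just estimated.\<close>
  then show ?thesis
    by (simp add: rel_entropy_def sum_distrib_left mult.commute[of _ "f _"])
qed

section \<open>Marginals of the Gibbs measure\<close>

text \<open>\<open>undefined\<close> outside \<open>{1..k+l}\<close> is forced by
  \<open>configs\<close>, whose elements are extensional; the second block is shifted because its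
  own sites start at 1.\<close>

definition append_config :: "nat \<Rightarrow> nat \<Rightarrow> (nat \<Rightarrow> 'c) \<Rightarrow> (nat \<Rightarrow> 'c) \<Rightarrow> nat \<Rightarrow> 'c" where
  "append_config k l \<tau> \<tau>' =
     (\<lambda>i. if i \<in> {1..k} then \<tau> i else if i \<in> {k+1..k+l} then \<tau>' (i - k) else undefined)"

lemma append_config_in: "append_config k l \<tau> \<tau>' \<in> configs (k + l)"
  by (auto simp: append_config_def configs_def PiE_iff extensional_def)

lemma restrict_append_config: "\<tau> \<in> configs k \<Longrightarrow> restrict (append_config k l \<tau> \<tau>') {1..k} = \<tau>"
  by (auto simp: append_config_def configs_def PiE_iff extensional_def)

lemma inj_on_append_config: "inj_on (append_config k l \<tau>) (configs l)"
proof (rule inj_onI)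
  fix x y assume xy: "x \<in> configs l" "y \<in> configs l" "append_config k l \<tau> x = append_config k l \<tau> y"
  show "x = y"
  proof
    fix i
    show "x i = y i"
    proof (cases "i \<in> {1..l}")
      case True
      with fun_cong[OF xy(3), of "i + k"] show ?thesis by (auto simp: append_config_def)
    next
      case False
      with xy show ?thesis by (metis PiE_arb configs_def)
    qed
  qed
qed

lemma counts_append_config: "counts (k + l) (append_config k l \<tau> \<tau>') = counts k \<tau> + counts l \<tau>'"
proof -
  have "(\<Sum>i=1..k+l. of_bool (append_config k l \<tau> \<tau>' i = c))
      = (\<Sum>i=1..k. of_bool (\<tau> i = c)) + (\<Sum>i=1..l. of_bool (\<tau>' i = c) :: real)" for c
  proof -
    have "(\<Sum>i=1..k+l. of_bool (append_config k l \<tau> \<tau>' i = c))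
      = (\<Sum>i=1..k. of_bool (append_config k l \<tau> \<tau>' i = c))
        + (\<Sum>i=k+1..k+l. of_bool (append_config k l \<tau> \<tau>' i = c) :: real)"
      by (rule sum.ub_add_nat) simp
    also have "(\<Sum>i=1..k. of_bool (append_config k l \<tau> \<tau>' i = c))
      = (\<Sum>i=1..k. of_bool (\<tau> i = c) :: real)"
      by (intro sum.cong) (auto simp: append_config_def)
    also have "(\<Sum>i=k+1..k+l. of_bool (append_config k l \<tau> \<tau>' i = c))
      = (\<Sum>i=1..l. of_bool (\<tau>' i = c) :: real)"
      by (rule sum.reindex_bij_witness[of _ "\<lambda>i. i + k" "\<lambda>i. i - k"]) (auto simp: append_config_def)
    finally show ?thesis .
  qed
  then show ?thesis by (simp add: counts_def vec_eq_iff)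
qed

text \<open>The point masses of \<open>gibbs_marginal\<close>, by \<open>gibbs_marginal_eq\<close>.
  As a sum over all completions of \<open>\<tau>\<close>, it is bounded below by keeping only some
  of them.\<close>

definition marginal_weight ::
  "(real ^ 'c::finite \<Rightarrow> real) \<Rightarrow> nat \<Rightarrow> nat \<Rightarrow> (nat \<Rightarrow> 'c) \<Rightarrow> real" where
  "marginal_weight F N k \<tau> =
     (\<Sum>\<sigma>\<in>{\<sigma>\<in>configs N. restrict \<sigma> {1..k} = \<tau>}. exp (real N * F (emp N \<sigma>))) / partition_fun F N"

lemma configs_nonempty: "configs N \<noteq> ({} :: (nat \<Rightarrow> 'c) set)"
  by (simp add: configs_def PiE_eq_empty_iff)

lemma partition_fun_pos: "0 < partition_fun F N"
  unfolding partition_fun_def by (intro sum_pos) (auto simp: configs_nonempty)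

lemma restrict_configs: "k \<le> N \<Longrightarrow> \<sigma> \<in> configs N \<Longrightarrow> restrict \<sigma> {1..k} \<in> configs k"
  by (auto simp: configs_def)

lemma marginal_weight_nonneg: "0 \<le> marginal_weight F N k \<tau>"
  unfolding marginal_weight_def by (intro divide_nonneg_pos partition_fun_pos sum_nonneg) auto

lemma sum_marginal_weight:
  assumes "k \<le> N" shows "(\<Sum>\<tau>\<in>configs k. marginal_weight F N k \<tau>) = 1"
proof -
  have "(\<Sum>\<tau>\<in>configs k. \<Sum>\<sigma>\<in>{\<sigma>\<in>configs N. restrict \<sigma> {1..k} = \<tau>}. exp (real N * F (emp N \<sigma>)))
      = partition_fun F N"
    unfolding partition_fun_def using assms restrict_configs by (intro sum.group) auto
  then show ?thesis
    using partition_fun_pos[of F N] by (simp add: marginal_weight_def flip: sum_divide_distrib)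
qed

lemma gibbs_marginal_eq:
  fixes F :: "real ^ 'c::finite \<Rightarrow> real"
  assumes "k \<le> N"
  shows "gibbs_marginal F N k = point_measure (configs k) (\<lambda>\<tau>. ennreal (marginal_weight F N k \<tau>))"
proof (rule measure_eqI_finite[where A = "configs k"])
  fix \<tau> :: "nat \<Rightarrow> 'c" assume \<tau>: "\<tau> \<in> configs k"
  have meas: "(\<lambda>\<sigma>. restrict \<sigma> {1..k}) \<in> gibbs F N \<rightarrow>\<^sub>M count_space (configs k)"
    using restrict_configs[OF assms] by (auto simp: gibbs_def)
  have eq: "(\<lambda>\<sigma>. restrict \<sigma> {1..k}) -` {\<tau>} \<inter> space (gibbs F N) = {\<sigma>\<in>configs N. restrict \<sigma> {1..k} = \<tau>}"
    by (auto simp: gibbs_def space_point_measure)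
  have "emeasure (gibbs_marginal F N k) {\<tau>} = emeasure (gibbs F N) {\<sigma>\<in>configs N. restrict \<sigma> {1..k} = \<tau>}"
    using \<tau> emeasure_distr[OF meas, of "{\<tau>}"] unfolding eq gibbs_marginal_def by simp
  also have "\<dots> = (\<Sum>\<sigma>\<in>{\<sigma>\<in>configs N. restrict \<sigma> {1..k} = \<tau>}.
      ennreal (exp (real N * F (emp N \<sigma>)) / partition_fun F N))"
    unfolding gibbs_def by (subst emeasure_point_measure_finite) auto
  also have "\<dots> = ennreal (marginal_weight F N k \<tau>)"
    unfolding marginal_weight_def sum_divide_distrib
    by (rule sum_ennreal) (simp add: less_imp_le[OF partition_fun_pos])
  finally show "emeasure (gibbs_marginal F N k) {\<tau>}
      = emeasure (point_measure (configs k) (\<lambda>\<tau>. ennreal (marginal_weight F N k \<tau>))) {\<tau>}"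
    using \<tau> by (simp add: emeasure_point_measure_finite)
qed (simp_all add: gibbs_marginal_def sets_point_measure)

section \<open>Upper bound for the partition function\<close>

text \<open>Apply \<open>ln x \<le> x - 1\<close> at \<open>x = m / v\<close> for each colour; the
  linear terms left over cancel since both vectors have total 1. The bound is quadratic, so after
  multiplication by \<open>N\<close> a parameter at distance of order 1 / sqrt N costs only a
  constant.\<close>

lemma chi_square_bound:
  assumes m: "m \<in> prob_simplex" and v: "v \<in> prob_simplex" and pos: "\<And>c. 0 < v $ c"
  shows "(\<Sum>c\<in>UNIV. m $ c * (ln (m $ c) - ln (v $ c))) \<le> (\<Sum>c\<in>UNIV. (m $ c - v $ c)\<^sup>2 / v $ c)"
proof -
  have "(\<Sum>c\<in>UNIV. m $ c * (ln (m $ c) - ln (v $ c))) \<le> (\<Sum>c\<in>UNIV. m $ c * (m $ c / v $ c - 1))"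
  proof (rule sum_mono)
    fix c
    show "m $ c * (ln (m $ c) - ln (v $ c)) \<le> m $ c * (m $ c / v $ c - 1)"
    proof (cases "m $ c = 0")
      case False
      then have mp: "0 < m $ c" using m by (auto simp: prob_simplex_def order_le_less)
      with pos[of c] have "ln (m $ c / v $ c) \<le> m $ c / v $ c - 1" by (intro ln_le_minus_one) auto
      with mp pos[of c] show ?thesis by (intro mult_left_mono) (auto simp: ln_div)
    qed simp
  qed
  also have "\<dots> = (\<Sum>c\<in>UNIV. (m $ c - v $ c)\<^sup>2 / v $ c + (m $ c - v $ c))"
  proof (intro sum.cong refl)
    fix c
    have "v $ c \<noteq> 0" using pos[of c] by simp
    then show "m $ c * (m $ c / v $ c - 1) = (m $ c - v $ c)\<^sup>2 / v $ c + (m $ c - v $ c)"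
      by (simp add: field_simps power2_eq_square)
  qed
  also have "\<dots> = (\<Sum>c\<in>UNIV. (m $ c - v $ c)\<^sup>2 / v $ c)"
    using m v by (simp add: sum.distrib sum_subtractf prob_simplex_def)
  finally show ?thesis .
qed

text \<open>Domination by a geometric series, as \<open>n \<le> n\<^sup>2\<close>; the factor 2
  accounts for the signs. Uniformity in \<open>N\<close> is the point: no power of \<open>N\<close>
  is lost.\<close>

lemma gauss_lattice_sum_bounded:
  fixes c :: real
  assumes "0 < c"
  shows "\<exists>K>0. \<forall>N. (\<Sum>z\<in>{- int N..int N}. exp (- c * (real_of_int z)\<^sup>2)) \<le> K"
proof (intro exI[of _ "2 / (1 - exp (- c))"] conjI allI)
  show "0 < 2 / (1 - exp (- c))" using assms by simp
  fix N
  define h where "h = (\<lambda>(n, s). s * int n)"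
  have sub: "{- int N..int N} \<subseteq> h ` ({..N} \<times> {1, - 1})"
  proof
    fix z assume z: "z \<in> {- int N..int N}"
    show "z \<in> h ` ({..N} \<times> {1, - 1})"
    proof (cases "0 \<le> z")
      case True
      with z show ?thesis by (intro image_eqI[of _ _ "(nat z, 1)"]) (auto simp: h_def)
    next
      case False
      with z show ?thesis by (intro image_eqI[of _ _ "(nat (- z), - 1)"]) (auto simp: h_def)
    qed
  qed
  have "(\<Sum>z\<in>{- int N..int N}. exp (- c * (real_of_int z)\<^sup>2))
      \<le> (\<Sum>z\<in>h ` ({..N} \<times> {1, - 1}). exp (- c * (real_of_int z)\<^sup>2))"
    by (intro sum_mono2 sub) auto
  also have "\<dots> \<le> (\<Sum>p\<in>{..N} \<times> {1, - 1}. exp (- c * (real_of_int (h p))\<^sup>2))"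
    using sum_image_le[of "{..N} \<times> {1, - 1}" "\<lambda>z. exp (- c * (real_of_int z)\<^sup>2)" h] by (simp add: o_def)
  also have "\<dots> = (\<Sum>n\<le>N. \<Sum>s\<in>{1, - 1}. exp (- c * (real_of_int (h (n, s)))\<^sup>2))"
    by (subst sum.cartesian_product) auto
  also have "\<dots> = 2 * (\<Sum>n\<le>N. exp (- c * (real n)\<^sup>2))"
    by (simp add: h_def sum_distrib_left)
  also have "\<dots> \<le> 2 * (\<Sum>n\<le>N. exp (- c) ^ n)"
  proof (intro mult_left_mono sum_mono)
    fix n :: nat
    have "real n \<le> (real n)\<^sup>2" by (cases n) (auto simp: power2_eq_square)
    with assms have "c * real n \<le> c * (real n)\<^sup>2" by (intro mult_left_mono) auto
    then show "exp (- c * (real n)\<^sup>2) \<le> exp (- c) ^ n"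
      by (simp add: mult.commute flip: exp_of_nat_mult)
  qed simp
  also have "(\<Sum>n\<le>N. exp (- c) ^ n) \<le> (\<Sum>n. exp (- c) ^ n)"
    using assms by (intro sum_le_suminf summable_geometric) auto
  also have "\<dots> = 1 / (1 - exp (- c))" using assms by (intro suminf_geometric) auto
  finally show "(\<Sum>z\<in>{- int N..int N}. exp (- c * (real_of_int z)\<^sup>2)) \<le> 2 / (1 - exp (- c))" by simp
qed

text \<open>The linear part of \<open>lift\<close> (see \<open>lift_eq\<close>); its range is the
  space of vectors with total 0. The argument is a plain function so that integer lattice points can
  be inserted.\<close>

definition tangent :: "('n::finite \<Rightarrow> real) \<Rightarrow> real ^ 'n option" where
  "tangent x = (\<chi> c. case c of Some i \<Rightarrow> x i | None \<Rightarrow> - (\<Sum>i\<in>UNIV. x i))"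

lemma sum_option: "(\<Sum>c\<in>UNIV. f c) = f None + (\<Sum>i\<in>UNIV. f (Some i))" for f :: "'n::finite option \<Rightarrow> real"
  by (simp add: UNIV_option_conv sum.reindex)

lemma sum_tangent: "(\<Sum>c\<in>UNIV. tangent x $ c) = 0"
  by (simp add: sum_option tangent_def)

lemma tangent_of_sum_zero:
  assumes "(\<Sum>c\<in>UNIV. y $ c) = 0"
  shows "y = tangent (\<lambda>i. y $ Some i)"
proof -
  have "y $ None = - (\<Sum>i\<in>UNIV. y $ Some i)"
    using assms by (simp add: sum_option)
  then show ?thesis by (simp add: tangent_def vec_eq_iff split: option.split)
qed

lemma simplex_component_lower_bound:
  fixes v :: "real ^ 'c::finite"
  assumes "\<And>c. 0 < v $ c"
  obtains u where "0 < u" "\<And>c. u \<le> v $ c"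
proof
  show "0 < Min (range (($) v))" using assms by (subst Min_gr_iff) auto
  show "Min (range (($) v)) \<le> v $ c" for c by (intro Min_le) auto
qed

text \<open>Near a maximizer, \<open>exp (N F)\<close> is dominated by a Gaussian superposition of product measures
  whose parameters run through a lattice of mesh \<open>1 / sqrt N\<close> around it.\<close>

lemma partition_near:
  fixes F :: "real ^ ('n::finite option) \<Rightarrow> real"
  assumes v: "v \<in> prob_simplex" and pos: "\<And>c. 0 < v $ c" and c: "0 < c" and \<delta>: "0 < \<delta>"
    and bound: "\<And>m. m \<in> prob_simplex \<Longrightarrow> norm (m - v) \<le> \<delta> \<Longrightarrow> F m + ent m \<le> Gm - c * (norm (m - v))\<^sup>2"
  shows "\<exists>\<delta>'>0. \<exists>C>0. \<forall>\<^sub>F N in sequentially.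
    (\<Sum>\<sigma>\<in>{\<sigma>\<in>configs N. norm (emp N \<sigma> - v) < \<delta>'}. exp (real N * F (emp N \<sigma>))) \<le> C * exp (real N * Gm)"
proof -
  obtain u where u: "0 < u" "\<And>c. u \<le> v $ c"
    using simplex_component_lower_bound[OF pos] by blast
  obtain K where K: "0 < K" "\<And>N. (\<Sum>z\<in>{- int N..int N}. exp (- (c / 2) * (real_of_int z)\<^sup>2)) \<le> K"
    using gauss_lattice_sum_bounded[of "c / 2"] c by auto
  define n where "n = real CARD('n)"
  have n1: "1 \<le> n" by (simp add: n_def Suc_leI)
  \<comment> \<open>A deviation below \<open>u / 4\<close> plus a rounding error below
    \<open>u / 4\<close> leaves every component of the lattice parameter at least
    \<open>u / 2\<close>.\<close>
  define \<delta>' where "\<delta>' = min \<delta> (u / 4)"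
  \<comment> \<open>\<open>C2\<close> is \<open>N\<close> times the chi-square cost of rounding:
    \<open>n + 1\<close> colours, an error of \<open>n / sqrt N\<close> in each, denominators at
    least \<open>u / 2\<close>. In \<open>C\<close>, the term \<open>c * n\<close> is the rounding
    loss in the Gaussian weight and \<open>K ^ CARD('n)\<close> the product of one-dimensional
    lattice sums.\<close>
  define C2 where "C2 = (n + 1) * n\<^sup>2 * 2 / u"
  define C where "C = exp (C2 + c * n) * K ^ CARD('n)"
  have ev: "\<forall>\<^sub>F N in sequentially. n / sqrt (real N) < u / 4"
  proof -
    have "(\<lambda>N. n / sqrt (real N)) \<longlonglongrightarrow> 0" by real_asymp
    from order_tendstoD(2)[OF this, of "u / 4"] u show ?thesis by simp
  qed
  have "\<forall>\<^sub>F N in sequentially.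
    (\<Sum>\<sigma>\<in>{\<sigma>\<in>configs N. norm (emp N \<sigma> - v) < \<delta>'}. exp (real N * F (emp N \<sigma>))) \<le> C * exp (real N * Gm)"
    using ev eventually_gt_at_top[of 0]
  proof eventually_elim
    case (elim N)
    define s where "s = sqrt (real N)"
    have s: "0 < s" "s * s = real N" "s\<^sup>2 = real N" using elim by (auto simp: s_def)
    define w where "w z = v + (1 / s) *\<^sub>R tangent (\<lambda>i. real_of_int (z i))" for z :: "'n \<Rightarrow> int"
    define P where "P = (UNIV \<rightarrow>\<^sub>E {- int N..int N} :: ('n \<Rightarrow> int) set)"
    define S where "S = {z \<in> P. \<forall>c. u / 2 \<le> w z $ c}"
    define a where "a z = (\<Prod>i\<in>UNIV. exp (- (c / 2) * (real_of_int (z i))\<^sup>2))" for z :: "'n \<Rightarrow> int"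
    have finP: "finite P" unfolding P_def by (intro finite_PiE) auto
    have finS: "finite S" unfolding S_def using finP by simp
    have a0: "0 \<le> a z" for z unfolding a_def by (intro prod_nonneg) auto
    have w: "w z \<in> prob_simplex" "\<And>c. 0 < w z $ c" if "z \<in> S" for z
    proof -
      show p: "0 < w z $ c" for c using that u by (auto simp: S_def intro: less_le_trans[of 0 "u/2"])
      have "(\<Sum>c\<in>UNIV. w z $ c) = 1"
        using v sum_tangent[of "\<lambda>i. real_of_int (z i)"]
        by (simp add: w_def sum.distrib prob_simplex_def flip: sum_divide_distrib)
      with p show "w z \<in> prob_simplex" by (intro prob_simplexI) (auto intro: less_imp_le)
    qed
    have suma: "(\<Sum>z\<in>P. a z) \<le> K ^ CARD('n)"
    proof -
      have "(\<Sum>z\<in>P. a z) = (\<Prod>i\<in>(UNIV :: 'n set). \<Sum>z\<in>{- int N..int N}. exp (- (c / 2) * (real_of_int z)\<^sup>2))"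
        unfolding P_def a_def by (rule prod_sum_PiE[symmetric]) auto
      also have "\<dots> \<le> (\<Prod>i\<in>(UNIV :: 'n set). K)"
        by (intro prod_mono conjI K sum_nonneg) auto
      finally show ?thesis by simp
    qed
    \<comment> \<open>\<open>- ent m\<close> is the mean log-probability under \<open>w z\<close>
      plus the relative entropy of \<open>m\<close> with respect to \<open>w z\<close>. So the bound
      on \<open>F m + ent m\<close> makes \<open>exp (N * F m)\<close> at most a product probability
      times a Gaussian factor, up to a constant, once \<open>w z\<close> is within order 1 / sqrt N
      of \<open>m\<close>.\<close>
    have key: "exp (real N * F (emp N \<sigma>)) \<le> exp (real N * Gm) * exp (C2 + c * n) * (\<Sum>z\<in>S. a z * prodw N (w z) \<sigma>)"
      if \<sigma>: "\<sigma> \<in> configs N" "norm (emp N \<sigma> - v) < \<delta>'" for \<sigma>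
    proof -
      define m where "m = emp N \<sigma>"
      define y where "y = m - v"
      have m: "m \<in> prob_simplex" unfolding m_def using elim by (intro emp_in_simplex) simp
      have y: "norm y < \<delta>'" using \<sigma> by (simp add: y_def m_def)
      have yc: "\<bar>y $ c\<bar> < \<delta>'" for c using component_le_norm_cart[of y c] y by linarith
      have y1: "\<bar>y $ c\<bar> \<le> 1" for c
      proof -
        have "0 \<le> m $ c" "m $ c \<le> 1" "0 \<le> v $ c" "v $ c \<le> 1" using m v by (auto simp: prob_simplex_def)
        then show ?thesis by (simp add: y_def)
      qed
      have ysum: "(\<Sum>c\<in>UNIV. y $ c) = 0"
        using m v by (simp add: y_def sum_subtractf prob_simplex_def)
      \<comment> \<open>Each free coordinate is rounded down; the last one is determined by the
        others, so its error may accumulate to \<open>n / s\<close>.\<close>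
      define z where "z i = \<lfloor>s * y $ Some i\<rfloor>" for i
      define r where "r i = s * y $ Some i - real_of_int (z i)" for i
      have r: "0 \<le> r i" "r i \<le> 1" for i unfolding r_def z_def by linarith+
      have diff: "m - w z = (1 / s) *\<^sub>R tangent r"
      proof -
        have "s *\<^sub>R y = tangent (\<lambda>i. s * y $ Some i)"
          using tangent_of_sum_zero[of "s *\<^sub>R y"] ysum by (simp flip: sum_distrib_left)
        moreover have "tangent (\<lambda>i. s * y $ Some i) - tangent (\<lambda>i. real_of_int (z i)) = tangent r"
          by (simp add: r_def tangent_def vec_eq_iff sum_subtractf split: option.split)
        ultimately have "s *\<^sub>R y - tangent (\<lambda>i. real_of_int (z i)) = tangent r" by simp
        moreover have "m - w z = (1 / s) *\<^sub>R (s *\<^sub>R y - tangent (\<lambda>i. real_of_int (z i)))"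
          using s by (simp add: w_def y_def scaleR_diff_right)
        ultimately show ?thesis by simp
      qed
      have tr: "\<bar>tangent r $ c\<bar> \<le> n" for c
      proof (cases c)
        case None
        have "(\<Sum>i\<in>UNIV. r i) \<le> n" "0 \<le> (\<Sum>i\<in>UNIV. r i)"
          using sum_bounded_above[of UNIV r 1] r by (auto simp: n_def sum_nonneg)
        then show ?thesis by (simp add: None tangent_def)
      next
        case (Some i)
        show ?thesis using r[of i] n1 by (simp add: Some tangent_def)
      qed
      have mw: "\<bar>m $ c - w z $ c\<bar> \<le> n / s" for c
      proof -
        have "\<bar>(m - w z) $ c\<bar> = \<bar>tangent r $ c\<bar> / s" unfolding diff using s by simp
        also have "\<dots> \<le> n / s" using tr s by (simp add: divide_right_mono)
        finally show ?thesis by simp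
      qed
      have zS: "z \<in> S"
      proof -
        have "z i \<in> {- int N..int N}" for i
        proof -
          have "1 \<le> s" using elim by (simp add: s_def)
          then have "s * 1 \<le> s * s" by (intro mult_left_mono) auto
          then have "s \<le> real N" by (simp add: s)
          moreover have "\<bar>s * y $ Some i\<bar> \<le> s * 1" unfolding abs_mult using s y1 by (intro mult_mono) auto
          ultimately have "- real N \<le> s * y $ Some i" "s * y $ Some i \<le> real N" by linarith+
          then show ?thesis unfolding z_def by (simp add: le_floor_iff floor_le_iff)
        qed
        moreover have "u / 2 \<le> w z $ c" for c
        proof -
          have "n / s < u / 4" using elim(1) by (simp add: s_def)
          moreover have "\<bar>m $ c - v $ c\<bar> < u / 4" using yc[of c] by (simp add: y_def \<delta>'_def)
          ultimately show ?thesis using mw[of c] u(2)[of c] by linarith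
        qed
        ultimately show ?thesis by (auto simp: S_def P_def)
      qed
      have az: "exp (- c * real N * (norm y)\<^sup>2 - c * n) \<le> a z"
      proof -
        \<comment> \<open>The parallelogram identity for \<open>s * y $ Some i\<close> and
          \<open>r i\<close>. Its factor 2 is the reason for \<open>c / 2\<close> in
          \<open>a\<close>.\<close>
        have zb: "(real_of_int (z i))\<^sup>2 \<le> 2 * real N * (y $ Some i)\<^sup>2 + 2" for i
        proof -
          have "(real_of_int (z i))\<^sup>2 + (s * y $ Some i + r i)\<^sup>2 = 2 * (s * y $ Some i)\<^sup>2 + 2 * (r i)\<^sup>2"
            by (simp add: r_def power2_eq_square algebra_simps)
          moreover have "(r i)\<^sup>2 \<le> 1" using r[of i] by (simp add: power_le_one)
          ultimately show ?thesis using zero_le_power2[of "s * y $ Some i + r i"]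
            unfolding power_mult_distrib s by linarith
        qed
        have "(c / 2) * (\<Sum>i\<in>UNIV. (real_of_int (z i))\<^sup>2)
            \<le> (c / 2) * (\<Sum>i\<in>UNIV. 2 * real N * (y $ Some i)\<^sup>2 + 2)"
          using c zb by (intro mult_left_mono sum_mono) auto
        also have "\<dots> = c * real N * (\<Sum>i\<in>UNIV. (y $ Some i)\<^sup>2) + c * n"
          by (simp add: sum.distrib n_def distrib_left sum_distrib_left mult_ac)
        also have "\<dots> \<le> c * real N * (norm y)\<^sup>2 + c * n"
          using c by (intro add_right_mono mult_left_mono) (simp_all add: norm_vec_square sum_option)
        finally have le: "(c / 2) * (\<Sum>i\<in>UNIV. (real_of_int (z i))\<^sup>2) \<le> c * real N * (norm y)\<^sup>2 + c * n" .
        have "a z = exp (\<Sum>i\<in>UNIV. - (c / 2) * (real_of_int (z i))\<^sup>2)"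
          unfolding a_def by (rule exp_sum[symmetric]) simp
        also have "(\<Sum>i\<in>UNIV. - (c / 2) * (real_of_int (z i))\<^sup>2) = - (c / 2) * (\<Sum>i\<in>UNIV. (real_of_int (z i))\<^sup>2)"
          by (rule sum_distrib_left[symmetric])
        finally show ?thesis using le by simp
      qed
      have wz: "real N * (\<Sum>c\<in>UNIV. m $ c * (ln (m $ c) - ln (w z $ c))) \<le> C2"
      proof -
        have "(\<Sum>c\<in>UNIV. m $ c * (ln (m $ c) - ln (w z $ c))) \<le> (\<Sum>c\<in>UNIV. (m $ c - w z $ c)\<^sup>2 / w z $ c)"
          by (intro chi_square_bound m w zS)
        also have "\<dots> \<le> (\<Sum>c\<in>(UNIV :: 'n option set). (n / s)\<^sup>2 / (u / 2))"
        proof (intro sum_mono frac_le)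
          fix c
          show "(m $ c - w z $ c)\<^sup>2 \<le> (n / s)\<^sup>2" using mw[of c] by (metis abs_ge_zero power2_abs power_mono)
          show "u / 2 \<le> w z $ c" using zS by (simp add: S_def)
        qed (use u in auto)
        also have "\<dots> = (n + 1) * (n\<^sup>2 / real N) * (2 / u)"
          by (simp add: n_def power_divide s add.commute)
        finally have "real N * (\<Sum>c\<in>UNIV. m $ c * (ln (m $ c) - ln (w z $ c)))
            \<le> real N * ((n + 1) * (n\<^sup>2 / real N) * (2 / u))" by (intro mult_left_mono) auto
        also have "\<dots> = C2" using elim by (simp add: C2_def)
        finally show ?thesis .
      qed
      have pw: "prodw N (w z) \<sigma> = exp (real N * (\<Sum>c\<in>UNIV. m $ c * ln (w z $ c)))"
        using w[OF zS] by (simp add: prodw_eq_exp m_def counts_eq_emp sum_distrib_left mult.assoc)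
      have "F m + ent m \<le> Gm - c * (norm y)\<^sup>2"
        using bound[OF m] y by (simp add: y_def \<delta>'_def)
      then have "real N * (F m + ent m) \<le> real N * (Gm - c * (norm y)\<^sup>2)" by (intro mult_left_mono) auto
      moreover have "real N * (\<Sum>c\<in>UNIV. m $ c * (ln (m $ c) - ln (w z $ c)))
         = - real N * ent m - real N * (\<Sum>c\<in>UNIV. m $ c * ln (w z $ c))"
        by (simp add: ent_def right_diff_distrib sum_subtractf)
      ultimately have "real N * F m \<le> real N * Gm + (C2 + c * n)
          + (- c * real N * (norm y)\<^sup>2 - c * n) + real N * (\<Sum>c\<in>UNIV. m $ c * ln (w z $ c))"
        using wz by (simp add: algebra_simps)
      then have "exp (real N * F m) \<le> exp (real N * Gm) * exp (C2 + c * n)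
          * exp (- c * real N * (norm y)\<^sup>2 - c * n) * prodw N (w z) \<sigma>"
        unfolding pw by (simp flip: exp_add)
      also have "\<dots> = exp (real N * Gm) * exp (C2 + c * n)
          * (exp (- c * real N * (norm y)\<^sup>2 - c * n) * prodw N (w z) \<sigma>)"
        by (simp only: mult.assoc)
      also have "\<dots> \<le> exp (real N * Gm) * exp (C2 + c * n) * (a z * prodw N (w z) \<sigma>)"
        using az prodw_nonneg[OF w(1)[OF zS]] by (intro mult_left_mono mult_right_mono) auto
      also have "\<dots> \<le> exp (real N * Gm) * exp (C2 + c * n) * (\<Sum>z\<in>S. a z * prodw N (w z) \<sigma>)"
        by (intro mult_left_mono member_le_sum[OF zS] finS mult_nonneg_nonneg a0 prodw_nonneg w) auto
      finally show ?thesis by (simp add: m_def)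
    qed
    have "(\<Sum>\<sigma>\<in>{\<sigma>\<in>configs N. norm (emp N \<sigma> - v) < \<delta>'}. exp (real N * F (emp N \<sigma>)))
        \<le> (\<Sum>\<sigma>\<in>{\<sigma>\<in>configs N. norm (emp N \<sigma> - v) < \<delta>'}.
             exp (real N * Gm) * exp (C2 + c * n) * (\<Sum>z\<in>S. a z * prodw N (w z) \<sigma>))"
      by (intro sum_mono key) auto
    \<comment> \<open>Over all configurations each product measure has total mass 1, so that only
      the Gaussian lattice sum survives.\<close>
    also have "\<dots> \<le> (\<Sum>\<sigma>\<in>configs N. exp (real N * Gm) * exp (C2 + c * n) * (\<Sum>z\<in>S. a z * prodw N (w z) \<sigma>))"
      by (intro sum_mono2) (auto intro!: mult_nonneg_nonneg sum_nonneg a0 prodw_nonneg w)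
    also have "\<dots> = exp (real N * Gm) * exp (C2 + c * n) * (\<Sum>z\<in>S. a z * (\<Sum>\<sigma>\<in>configs N. prodw N (w z) \<sigma>))"
      unfolding sum_distrib_left[symmetric] by (subst sum.swap) (simp add: sum_distrib_left)
    also have "(\<Sum>z\<in>S. a z * (\<Sum>\<sigma>\<in>configs N. prodw N (w z) \<sigma>)) = (\<Sum>z\<in>S. a z)"
      by (intro sum.cong refl) (simp add: prodw_total w)
    also have "\<dots> \<le> (\<Sum>z\<in>P. a z)" by (intro sum_mono2 finP a0) (auto simp: S_def)
    also note suma
    finally show ?case by (simp add: C_def mult_ac)
  qed
  moreover have "0 < \<delta>'" "0 < C" using \<delta> u K by (auto simp: \<delta>'_def C_def)
  ultimately show ?thesis by blast
qed

section \<open>Configurations away from the maximizers, and the total bound\<close>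

lemma card_emp_range: "card (emp N ` (configs N :: (nat \<Rightarrow> 'c::finite) set)) \<le> (N + 1) ^ CARD('c)"
proof -
  have sub: "emp N ` (configs N :: (nat \<Rightarrow> 'c) set)
      \<subseteq> (\<lambda>g. \<chi> c. real (g c) / real N) ` (UNIV \<rightarrow>\<^sub>E {..N})"
  proof (intro image_subsetI)
    fix \<sigma> :: "nat \<Rightarrow> 'c"
    have "card ({1..N} \<inter> {i. \<sigma> i = c}) \<le> card {1..N}" for c by (intro card_mono) auto
    then show "emp N \<sigma> \<in> (\<lambda>g. \<chi> c. real (g c) / real N) ` (UNIV \<rightarrow>\<^sub>E {..N})"
      by (intro image_eqI[of _ _ "\<lambda>c. card ({1..N} \<inter> {i. \<sigma> i = c})"]) (auto simp: emp_def)
  qed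
  have "card (emp N ` (configs N :: (nat \<Rightarrow> 'c) set)) \<le> card (UNIV \<rightarrow>\<^sub>E {..N} :: ('c \<Rightarrow> nat) set)"
    by (rule order_trans[OF card_mono[OF _ sub] card_image_le]) (auto intro!: finite_imageI finite_PiE)
  then show ?thesis by (simp add: card_PiE)
qed

text \<open>Absent colours have frequency 0, so \<open>prodw_eq_exp\<close> does not apply; they do
  not enter the product, and in the sum their count is 0. The identity replaces estimates of
  multinomial coefficients.\<close>

lemma prodw_emp:
  assumes "\<sigma> \<in> configs N" "1 \<le> N"
  shows "prodw N (emp N \<sigma>) \<sigma> = exp (- real N * ent (emp N \<sigma>))"
proof -
  have pos: "0 < emp N \<sigma> $ \<sigma> i" if "i \<in> {1..N}" for i
  proof -
    have "0 < (\<Sum>i'=1..N. of_bool (\<sigma> i' = \<sigma> i) :: real)"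
      using that by (intro sum_pos2[of _ i]) auto
    then show ?thesis using assms by (simp only: emp_def) simp
  qed
  have "prodw N (emp N \<sigma>) \<sigma> = exp (\<Sum>i=1..N. ln (emp N \<sigma> $ \<sigma> i))"
    unfolding prodw_def by (subst exp_sum) (auto intro!: prod.cong simp: pos[simplified] exp_ln)
  also have "(\<Sum>i=1..N. ln (emp N \<sigma> $ \<sigma> i)) = (\<Sum>c\<in>UNIV. counts N \<sigma> $ c * ln (emp N \<sigma> $ c))"
    by (rule sum_counts[symmetric])
  finally show ?thesis by (simp add: ent_def sum_negf counts_eq_emp sum_distrib_left mult.assoc)
qed

text \<open>By \<open>prodw_emp\<close>, \<open>exp (- N * ent)\<close> is a probability under one
  of at most \<open>(N + 1) ^ CARD('c)\<close> product measures. Summing over configurations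
  therefore costs at most this factor, which \<open>exp (- \<eta> * N)\<close> absorbs.\<close>

lemma partition_far:
  fixes F :: "real ^ 'c::finite \<Rightarrow> real"
  assumes \<eta>: "0 < \<eta>" and bound: "\<And>m. m \<in> prob_simplex \<Longrightarrow> m \<in> B \<Longrightarrow> F m + ent m \<le> Gm - \<eta>"
  shows "\<forall>\<^sub>F N in sequentially.
    (\<Sum>\<sigma>\<in>{\<sigma>\<in>configs N. emp N \<sigma> \<in> B}. exp (real N * F (emp N \<sigma>))) \<le> exp (real N * Gm)"
proof -
  have "(\<lambda>N. (real N + 1) ^ CARD('c) * exp (- \<eta> * real N)) \<longlonglongrightarrow> 0"
  proof -
    have "((\<lambda>x. x ^ CARD('c) / exp x) \<longlongrightarrow> (0::real)) at_top" by (rule tendsto_power_div_exp_0)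
    moreover have "filterlim (\<lambda>N. \<eta> * (real N + 1)) at_top sequentially" using \<eta> by real_asymp
    ultimately have "(\<lambda>N. (\<eta> * (real N + 1)) ^ CARD('c) / exp (\<eta> * (real N + 1))) \<longlonglongrightarrow> 0"
      by (rule filterlim_compose)
    then have "(\<lambda>N. exp \<eta> / \<eta> ^ CARD('c) * ((\<eta> * (real N + 1)) ^ CARD('c) / exp (\<eta> * (real N + 1)))) \<longlonglongrightarrow> exp \<eta> / \<eta> ^ CARD('c) * 0"
      by (rule tendsto_mult_left)
    moreover have "exp \<eta> / \<eta> ^ CARD('c) * ((\<eta> * (real N + 1)) ^ CARD('c) / exp (\<eta> * (real N + 1)))
        = (real N + 1) ^ CARD('c) * exp (- \<eta> * real N)" for N
      using \<eta> by (subst power_mult_distrib) (simp add: distrib_left exp_add exp_minus field_simps)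
    ultimately show ?thesis by simp
  qed
  then have "\<forall>\<^sub>F N in sequentially. (real N + 1) ^ CARD('c) * exp (- \<eta> * real N) < 1"
    by (rule order_tendstoD(2)) simp
  then show ?thesis using eventually_ge_at_top[of 1]
  proof eventually_elim
    case (elim N)
    define W where "W = emp N ` (configs N :: (nat \<Rightarrow> 'c) set)"
    have W: "w \<in> prob_simplex" if "w \<in> W" for w
      using that elim emp_in_simplex by (auto simp: W_def)
    have key: "exp (real N * F (emp N \<sigma>)) \<le> exp (real N * (Gm - \<eta>)) * (\<Sum>w\<in>W. prodw N w \<sigma>)"
      if \<sigma>: "\<sigma> \<in> configs N" "emp N \<sigma> \<in> B" for \<sigma>
    proof -
      have "real N * (F (emp N \<sigma>) + ent (emp N \<sigma>)) \<le> real N * (Gm - \<eta>)"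
        using bound[OF emp_in_simplex[OF elim(2)] \<sigma>(2)] by (intro mult_left_mono) auto
      then have "exp (real N * F (emp N \<sigma>)) \<le> exp (real N * (Gm - \<eta>)) * prodw N (emp N \<sigma>) \<sigma>"
        unfolding prodw_emp[OF \<sigma>(1) elim(2)] exp_add[symmetric] by (simp add: algebra_simps)
      also have "\<dots> \<le> exp (real N * (Gm - \<eta>)) * (\<Sum>w\<in>W. prodw N w \<sigma>)"
        using \<sigma> by (intro mult_left_mono member_le_sum prodw_nonneg W) (auto simp: W_def)
      finally show ?thesis .
    qed
    have "(\<Sum>\<sigma>\<in>{\<sigma>\<in>configs N. emp N \<sigma> \<in> B}. exp (real N * F (emp N \<sigma>)))
       \<le> (\<Sum>\<sigma>\<in>{\<sigma>\<in>configs N. emp N \<sigma> \<in> B}. exp (real N * (Gm - \<eta>)) * (\<Sum>w\<in>W. prodw N w \<sigma>))"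
      by (intro sum_mono key) auto
    also have "\<dots> \<le> (\<Sum>\<sigma>\<in>configs N. exp (real N * (Gm - \<eta>)) * (\<Sum>w\<in>W. prodw N w \<sigma>))"
      by (intro sum_mono2) (auto intro!: mult_nonneg_nonneg sum_nonneg prodw_nonneg W)
    also have "\<dots> = exp (real N * (Gm - \<eta>)) * (\<Sum>w\<in>W. \<Sum>\<sigma>\<in>configs N. prodw N w \<sigma>)"
      unfolding sum_distrib_left[symmetric] by (subst sum.swap) simp
    also have "(\<Sum>w\<in>W. \<Sum>\<sigma>\<in>configs N. prodw N w \<sigma>) = real (card W)"
      by (simp add: prodw_total W)
    also have "\<dots> \<le> (real N + 1) ^ CARD('c)"
      using card_emp_range[of N, where 'c = 'c] unfolding W_def
      by (metis of_nat_1 of_nat_add of_nat_le_iff of_nat_power)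
    also have "exp (real N * (Gm - \<eta>)) * (real N + 1) ^ CARD('c)
        = exp (real N * Gm) * ((real N + 1) ^ CARD('c) * exp (- \<eta> * real N))"
      by (simp add: right_diff_distrib exp_diff exp_minus field_simps)
    also have "\<dots> \<le> exp (real N * Gm) * 1"
      using elim(1) by (intro mult_left_mono) auto
    finally show ?case by simp
  qed
qed

text \<open>The radii supplied by \<open>partition_near\<close> are fixed first; \<open>far\<close>
  is then applied to the union of the resulting balls, so every empirical measure falls under one of
  the two bounds.\<close>

lemma partition_fun_bound:
  fixes F :: "real ^ ('n::finite option) \<Rightarrow> real"
  assumes fin: "finite V" and V: "V \<subseteq> prob_simplex" and pos: "\<And>v c. v \<in> V \<Longrightarrow> 0 < v $ c"
    and near: "\<And>v. v \<in> V \<Longrightarrow> \<exists>c>0. \<exists>\<delta>>0. \<forall>m\<in>prob_simplex. norm (m - v) \<le> \<delta> \<longrightarrow>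
      F m + ent m \<le> Gm - c * (norm (m - v))\<^sup>2"
    and far: "\<And>U. open U \<Longrightarrow> V \<subseteq> U \<Longrightarrow> \<exists>\<eta>>0. \<forall>m\<in>prob_simplex - U. F m + ent m \<le> Gm - \<eta>"
  shows "\<exists>C>0. \<forall>\<^sub>F N in sequentially. partition_fun F N \<le> C * exp (real N * Gm)"
proof -
  define near_bound where "near_bound v \<delta> C \<longleftrightarrow> (\<forall>\<^sub>F N in sequentially.
    (\<Sum>\<sigma>\<in>{\<sigma>\<in>configs N. norm (emp N \<sigma> - v) < \<delta>}. exp (real N * F (emp N \<sigma>))) \<le> C * exp (real N * Gm))"
    for v \<delta> C
  have "\<exists>\<delta>>0. \<exists>C>0. near_bound v \<delta> C" if v: "v \<in> V" for v
  proof -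
    obtain c \<delta> where c: "0 < c" "0 < \<delta>"
        "\<forall>m\<in>prob_simplex. norm (m - v) \<le> \<delta> \<longrightarrow> F m + ent m \<le> Gm - c * (norm (m - v))\<^sup>2"
      using near[OF v] by blast
    show ?thesis
      unfolding near_bound_def
      by (rule partition_near[OF _ pos c(1,2)]) (use c(3) V v pos in auto)
  qed
  then obtain \<delta> C where \<delta>: "\<And>v. v \<in> V \<Longrightarrow> 0 < \<delta> v" and C: "\<And>v. v \<in> V \<Longrightarrow> 0 < C v"
    and near': "\<And>v. v \<in> V \<Longrightarrow> near_bound v (\<delta> v) (C v)"
    by metis
  define U where "U = (\<Union>v\<in>V. ball v (\<delta> v))"
  have "open U" "V \<subseteq> U" using \<delta> by (auto simp: U_def)
  from far[OF this] obtain \<eta> where \<eta>: "0 < \<eta>" "\<And>m. m \<in> prob_simplex \<Longrightarrow> m \<in> - U \<Longrightarrow> F m + ent m \<le> Gm - \<eta>"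
    by auto
  have far': "\<forall>\<^sub>F N in sequentially.
    (\<Sum>\<sigma>\<in>{\<sigma>\<in>configs N. emp N \<sigma> \<in> - U}. exp (real N * F (emp N \<sigma>))) \<le> exp (real N * Gm)"
    by (rule partition_far[OF \<eta>])
  have "\<forall>\<^sub>F N in sequentially. \<forall>v\<in>V.
    (\<Sum>\<sigma>\<in>{\<sigma>\<in>configs N. norm (emp N \<sigma> - v) < \<delta> v}. exp (real N * F (emp N \<sigma>))) \<le> C v * exp (real N * Gm)"
    using near' fin unfolding near_bound_def by (simp add: eventually_ball_finite)
  then have "\<forall>\<^sub>F N in sequentially. partition_fun F N \<le> (1 + (\<Sum>v\<in>V. C v)) * exp (real N * Gm)"
    using far'
  proof eventually_elim
    case (elim N)
    let ?e = "\<lambda>\<sigma>. exp (real N * F (emp N \<sigma>))"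
    have "?e \<sigma> \<le> of_bool (emp N \<sigma> \<notin> U) * ?e \<sigma> + (\<Sum>v\<in>V. of_bool (norm (emp N \<sigma> - v) < \<delta> v) * ?e \<sigma>)" for \<sigma>
    proof (cases "emp N \<sigma> \<in> U")
      case True
      then obtain v where v: "v \<in> V" "norm (emp N \<sigma> - v) < \<delta> v"
        by (auto simp: U_def dist_norm norm_minus_commute)
      have "?e \<sigma> \<le> (\<Sum>v\<in>V. of_bool (norm (emp N \<sigma> - v) < \<delta> v) * ?e \<sigma>)"
        using member_le_sum[OF v(1), of "\<lambda>v. of_bool (norm (emp N \<sigma> - v) < \<delta> v) * ?e \<sigma>"] v(2) fin by simp
      then show ?thesis using True by simp
    qed (simp add: sum_nonneg)
    then have "partition_fun F N \<le> (\<Sum>\<sigma>\<in>configs N. of_bool (emp N \<sigma> \<notin> U) * ?e \<sigma>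
        + (\<Sum>v\<in>V. of_bool (norm (emp N \<sigma> - v) < \<delta> v) * ?e \<sigma>))"
      unfolding partition_fun_def by (intro sum_mono)
    also have "\<dots> = (\<Sum>\<sigma>\<in>{\<sigma>\<in>configs N. emp N \<sigma> \<in> - U}. ?e \<sigma>)
        + (\<Sum>v\<in>V. \<Sum>\<sigma>\<in>{\<sigma>\<in>configs N. norm (emp N \<sigma> - v) < \<delta> v}. ?e \<sigma>)"
      by (subst sum.distrib, subst sum.swap) (simp add: sum.inter_filter of_bool_def if_distribR if_distrib cong: if_cong)
    also have "\<dots> \<le> exp (real N * Gm) + (\<Sum>v\<in>V. C v * exp (real N * Gm))"
      using elim by (intro add_mono sum_mono) auto
    finally show ?case by (simp add: distrib_right sum_distrib_right)
  qed
  moreover have "0 < 1 + (\<Sum>v\<in>V. C v)" using C by (intro add_pos_nonneg sum_nonneg) (auto intro: less_imp_le)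
  ultimately show ?thesis by blast
qed

section \<open>Quadratic expansions at the maximizers\<close>

text \<open>Minimum over the compact unit sphere, spread by homogeneity. It serves both for the form
  of \<open>H_mat\<close> and for the Fisher form minus it.\<close>

lemma square_homogeneous_coercive:
  fixes Q :: "'a::euclidean_space \<Rightarrow> real"
  assumes cont: "continuous_on UNIV Q" and hom: "\<And>s x. Q (s *\<^sub>R x) = s\<^sup>2 * Q x"
    and pos: "\<And>x. x \<noteq> 0 \<Longrightarrow> 0 < Q x"
  shows "\<exists>b>0. \<forall>x. b * (norm x)\<^sup>2 \<le> Q x"
proof -
  have ne: "sphere (0::'a) 1 \<noteq> {}" by simp
  have "continuous_on (sphere 0 1) Q" using cont continuous_on_subset by blast
  from continuous_attains_inf[OF compact_sphere ne this]
  obtain x0 where x0: "x0 \<in> sphere 0 1" "\<And>y. y \<in> sphere 0 1 \<Longrightarrow> Q x0 \<le> Q y" by blast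
  have "Q x0 * (norm x)\<^sup>2 \<le> Q x" for x
  proof (cases "x = 0")
    case True
    have "Q 0 = 0" using hom[of 0 0] by simp
    with True show ?thesis by simp
  next
    case False
    then have "Q x0 \<le> Q ((1 / norm x) *\<^sub>R x)" by (intro x0) simp
    also have "\<dots> = Q x / (norm x)\<^sup>2" unfolding hom by (simp add: power_divide)
    finally show ?thesis using False by (simp add: field_simps)
  qed
  moreover have "0 < Q x0" using x0(1) by (intro pos) auto
  ultimately show ?thesis by blast
qed

text \<open>The quadratic part is subtracted along the segment from \<open>x\<close> to
  \<open>x + h\<close> and the mean value theorem applied. Differentiability of the partial
  derivatives at \<open>x\<close> controls each of them up to \<open>e / n * norm h\<close>, and
  \<open>n\<close> of them add up.\<close>

lemma second_order_expansion:
  fixes f :: "real ^ 'n::finite \<Rightarrow> real"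
  assumes S: "open S" "x \<in> S" and diff: "\<And>y. y \<in> S \<Longrightarrow> f differentiable (at y)"
    and diff2: "\<And>j. partial_deriv j f differentiable (at x)" and crit: "\<And>j. partial_deriv j f x = 0"
    and e: "0 < e"
  shows "\<exists>\<delta>>0. \<forall>h. norm h \<le> \<delta> \<longrightarrow> \<bar>f (x + h) - f x - (h \<bullet> (hessian f x *v h)) / 2\<bar> \<le> e * (norm h)\<^sup>2"
proof -
  define n where "n = real CARD('n)"
  have n: "0 < n" by (simp add: n_def)
  have expand: "D h = (\<Sum>i\<in>UNIV. h $ i * D (axis i 1))" if "linear D" for D :: "real ^ 'n \<Rightarrow> real" and h
  proof -
    have "D h = D (\<Sum>i\<in>UNIV. h $ i *\<^sub>R axis i 1)"
      using basis_expansion[of h] by (simp add: scalar_mult_eq_scaleR)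
    then show ?thesis by (simp add: linear_sum[OF that] linear_cmul[OF that])
  qed
  have "\<exists>\<delta>>0. \<forall>h. norm h < \<delta> \<longrightarrow>
    \<bar>partial_deriv j f (x + h) - (\<Sum>i\<in>UNIV. h $ i * hessian f x $ i $ j)\<bar> \<le> e / n * norm h" for j
  proof -
    let ?D = "frechet_derivative (partial_deriv j f) (at x)"
    have D: "(partial_deriv j f has_derivative ?D) (at x)"
      using diff2[of j] by (simp add: frechet_derivative_works)
    then have lin: "linear ?D" by (rule has_derivative_linear)
    have "0 < e / n" using e n by simp
    with D obtain \<delta> where \<delta>: "0 < \<delta>" "\<And>y. norm (y - x) < \<delta> \<Longrightarrow>
        norm (partial_deriv j f y - partial_deriv j f x - ?D (y - x)) \<le> e / n * norm (y - x)"
      unfolding has_derivative_at_alt by blast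
    have "\<bar>partial_deriv j f (x + h) - (\<Sum>i\<in>UNIV. h $ i * hessian f x $ i $ j)\<bar> \<le> e / n * norm h"
      if "norm h < \<delta>" for h
      using \<delta>(2)[of "x + h"] that expand[OF lin, of h] crit[of j]
      by (simp add: hessian_def partial_deriv_def[of _ "partial_deriv j f"])
    with \<delta>(1) show ?thesis by blast
  qed
  then obtain \<delta> where \<delta>: "\<And>j. 0 < \<delta> j" "\<And>j h. norm h < \<delta> j \<Longrightarrow>
    \<bar>partial_deriv j f (x + h) - (\<Sum>i\<in>UNIV. h $ i * hessian f x $ i $ j)\<bar> \<le> e / n * norm h" by metis
  obtain r where r: "0 < r" "ball x r \<subseteq> S" using S open_contains_ball by blast
  define \<delta>0 where "\<delta>0 = min r (Min (range \<delta>)) / 2"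
  have m0: "0 < Min (range \<delta>)" using \<delta>(1) by (subst Min_gr_iff) auto
  have \<delta>0: "0 < \<delta>0" "\<delta>0 < r" "\<And>j. \<delta>0 < \<delta> j"
  proof -
    show "0 < \<delta>0" "\<delta>0 < r" using r m0 by (auto simp: \<delta>0_def)
    fix j have "Min (range \<delta>) \<le> \<delta> j" by (intro Min_le) auto
    moreover have "\<delta>0 \<le> Min (range \<delta>) / 2" unfolding \<delta>0_def by (intro divide_right_mono) auto
    ultimately show "\<delta>0 < \<delta> j" using m0 by linarith
  qed
  have "\<bar>f (x + h) - f x - (h \<bullet> (hessian f x *v h)) / 2\<bar> \<le> e * (norm h)\<^sup>2" if h: "norm h \<le> \<delta>0" for h
  proof -
    define Q where "Q = h \<bullet> (hessian f x *v h)"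
    define g where "g t = f (x + t *\<^sub>R h) - t\<^sup>2 / 2 * Q" for t
    define g' where "g' t = (\<Sum>j\<in>UNIV. h $ j * partial_deriv j f (x + t *\<^sub>R h)) - t * Q" for t
    have small: "norm (t *\<^sub>R h) \<le> norm h" if "0 \<le> t" "t \<le> 1" for t
      using that by (simp add: mult_left_le_one_le)
    have deriv: "(g has_real_derivative g' t) (at t)" if t: "0 \<le> t" "t \<le> 1" for t
    proof -
      have "x + t *\<^sub>R h \<in> S" using small[OF t] h \<delta>0 r by (auto simp: subset_iff dist_norm)
      from diff[OF this] have D: "(f has_derivative frechet_derivative f (at (x + t *\<^sub>R h))) (at (x + t *\<^sub>R h))"
        by (simp add: frechet_derivative_works)
      have "((\<lambda>t. x + t *\<^sub>R h) has_derivative (\<lambda>s. s *\<^sub>R h)) (at t)"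
        by (auto intro!: derivative_eq_intros)
      from has_derivative_compose[OF this D]
      have "((\<lambda>t. f (x + t *\<^sub>R h)) has_derivative (\<lambda>s. frechet_derivative f (at (x + t *\<^sub>R h)) (s *\<^sub>R h))) (at t)" .
      moreover have "frechet_derivative f (at (x + t *\<^sub>R h)) (s *\<^sub>R h)
          = (\<Sum>j\<in>UNIV. h $ j * partial_deriv j f (x + t *\<^sub>R h)) * s" for s
        using expand[OF has_derivative_linear[OF D], of "s *\<^sub>R h"]
        by (simp add: partial_deriv_def sum_distrib_left sum_distrib_right mult_ac)
      ultimately have "((\<lambda>t. f (x + t *\<^sub>R h)) has_real_derivative
          (\<Sum>j\<in>UNIV. h $ j * partial_deriv j f (x + t *\<^sub>R h))) (at t)"
        by (simp add: has_field_derivative_def)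
      then show ?thesis unfolding g_def g'_def
        by (auto intro!: derivative_eq_intros)
    qed
    from MVT2[of 0 1 g g'] deriv obtain t where t: "0 < t" "t < 1" "g 1 - g 0 = g' t" by force
    \<comment> \<open>In \<open>hessian\<close> the row index belongs to the outer derivative; the
      sums are swapped to match the linearisation of \<open>partial_deriv j f\<close>.\<close>
    have Q: "Q = (\<Sum>j\<in>UNIV. h $ j * (\<Sum>i\<in>UNIV. h $ i * hessian f x $ i $ j))"
    proof -
      have "Q = (\<Sum>i\<in>UNIV. \<Sum>j\<in>UNIV. h $ i * (hessian f x $ i $ j * h $ j))"
        by (simp add: Q_def inner_vec_def matrix_vector_mult_def sum_distrib_left)
      also have "\<dots> = (\<Sum>j\<in>UNIV. \<Sum>i\<in>UNIV. h $ i * (hessian f x $ i $ j * h $ j))" by (rule sum.swap)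
      finally show ?thesis by (simp add: sum_distrib_left mult_ac)
    qed
    have "g' t = (\<Sum>j\<in>UNIV. h $ j * (partial_deriv j f (x + t *\<^sub>R h) - (\<Sum>i\<in>UNIV. (t *\<^sub>R h) $ i * hessian f x $ i $ j)))"
      by (simp add: g'_def Q right_diff_distrib sum_subtractf sum_distrib_left mult_ac)
    also have "\<bar>\<dots>\<bar> \<le> (\<Sum>j\<in>(UNIV :: 'n set). norm h * (e / n * norm h))"
    proof (rule order_trans[OF sum_abs], rule sum_mono)
      fix j
      have "\<bar>partial_deriv j f (x + t *\<^sub>R h) - (\<Sum>i\<in>UNIV. (t *\<^sub>R h) $ i * hessian f x $ i $ j)\<bar> \<le> e / n * norm (t *\<^sub>R h)"
        using small[of t] t h \<delta>0(3)[of j] by (intro \<delta>(2)) auto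
      also have "\<dots> \<le> e / n * norm h" using small[of t] t e n by (intro mult_left_mono) auto
      finally show "\<bar>h $ j * (partial_deriv j f (x + t *\<^sub>R h) - (\<Sum>i\<in>UNIV. (t *\<^sub>R h) $ i * hessian f x $ i $ j))\<bar>
          \<le> norm h * (e / n * norm h)"
        unfolding abs_mult by (intro mult_mono component_le_norm_cart) auto
    qed
    also have "\<dots> = e * (norm h)\<^sup>2" using n by (simp add: n_def power2_eq_square)
    finally show ?thesis using t(3) by (simp add: g_def Q_def)
  qed
  with \<delta>0(1) show ?thesis by blast
qed

text \<open>The summand of the relative entropy \<open>KL (m | v)\<close> is \<open>v ((1 + t) ln (1 + t))\<close> with
  \<open>t = (m - v) / v\<close>.\<close>

lemma entropy_taylor_lower:
  fixes t :: real
  assumes "-1 < t"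
  shows "t + t\<^sup>2 / 2 - t ^ 3 / 6 \<le> (1 + t) * ln (1 + t)"
proof -
  \<comment> \<open>\<open>g\<close> is the derivative of \<open>f\<close>, and its own derivative
    is \<open>s\<^sup>2 / (1 + s)\<close>. Since \<open>g 0 = 0\<close>, \<open>f\<close> decreases
    up to 0 and increases afterwards, with minimum \<open>f 0 = 0\<close>.\<close>
  define g where "g t = ln (1 + t) - t + t\<^sup>2 / 2" for t :: real
  define f where "f t = (1 + t) * ln (1 + t) - (t + t\<^sup>2 / 2 - t ^ 3 / 6)" for t :: real
  have dg: "\<exists>y. (g has_real_derivative y) (at s) \<and> 0 \<le> y" if "-1 < s" for s
  proof (intro exI conjI)
    show "(g has_real_derivative (1 / (1 + s) - 1 + s)) (at s)"
      unfolding g_def using that by (auto intro!: derivative_eq_intros)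
    have "1 / (1 + s) - 1 + s = s\<^sup>2 / (1 + s)" using that by (simp add: field_simps power2_eq_square)
    then show "0 \<le> 1 / (1 + s) - 1 + s" using that by simp
  qed
  have df: "(f has_real_derivative g s) (at s)" if "-1 < s" for s
    unfolding f_def g_def using that by (auto intro!: derivative_eq_intros simp: power2_eq_square)
  have g_pos: "0 \<le> g s" if "0 \<le> s" for s
    using DERIV_nonneg_imp_nondecreasing[of 0 s g] dg that by (auto simp: g_def)
  have g_neg: "g s \<le> 0" if "-1 < s" "s \<le> 0" for s
    using DERIV_nonneg_imp_nondecreasing[of s 0 g] dg that by (auto simp: g_def)
  have "0 \<le> f t"
  proof (cases "0 \<le> t")
    case True
    have "f 0 \<le> f t"
    proof (rule DERIV_nonneg_imp_nondecreasing[OF True])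
      fix s assume "0 \<le> s" "s \<le> t"
      then show "\<exists>y. (f has_real_derivative y) (at s) \<and> 0 \<le> y" using df[of s] g_pos[of s] by force
    qed
    then show ?thesis by (simp add: f_def)
  next
    case False
    have "f t \<ge> f 0"
    proof (rule DERIV_nonpos_imp_nonincreasing[of t 0 f])
      fix s assume "t \<le> s" "s \<le> 0"
      then show "\<exists>y. (f has_real_derivative y) (at s) \<and> y \<le> 0" using df[of s] g_neg[of s] assms by force
    qed (use False in simp)
    then show ?thesis by (simp add: f_def)
  qed
  then show ?thesis by (simp add: f_def)
qed

text \<open>Summing \<open>entropy_taylor_lower\<close> over the colours, the linear terms vanish
  because \<open>m\<close> and \<open>v\<close> have the same total, and \<open>e\<close> absorbs
  the cubic ones.\<close>

lemma relative_entropy_quadratic_lower: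
  fixes v :: "real ^ 'c::finite"
  assumes v: "v \<in> prob_simplex" and pos: "\<And>c. 0 < v $ c" and e: "0 < e"
  shows "\<exists>\<delta>>0. \<forall>m\<in>prob_simplex. norm (m - v) \<le> \<delta> \<longrightarrow>
    (\<Sum>c\<in>UNIV. (m $ c - v $ c)\<^sup>2 / v $ c) / 2 - e * (norm (m - v))\<^sup>2
      \<le> (\<Sum>c\<in>UNIV. m $ c * (ln (m $ c) - ln (v $ c)))"
proof -
  obtain u where u: "0 < u" "\<And>c. u \<le> v $ c"
    using simplex_component_lower_bound[OF pos] by blast
  \<comment> \<open>\<open>u / 2\<close> keeps \<open>m\<close> positive. The other bound gives
    \<open>t \<le> 6 * e * v $ c\<close>, hence a cubic term \<open>v $ c * t ^ 3 / 6\<close> of at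
    most \<open>e * (v $ c * t)\<^sup>2\<close>.\<close>
  define \<delta> where "\<delta> = min (u / 2) (6 * e * u\<^sup>2)"
  have "(\<Sum>c\<in>UNIV. (m $ c - v $ c)\<^sup>2 / v $ c) / 2 - e * (norm (m - v))\<^sup>2
      \<le> (\<Sum>c\<in>UNIV. m $ c * (ln (m $ c) - ln (v $ c)))"
    if m: "m \<in> prob_simplex" and d: "norm (m - v) \<le> \<delta>" for m
  proof -
    have summand: "(m $ c - v $ c) + (m $ c - v $ c)\<^sup>2 / v $ c / 2 - e * (m $ c - v $ c)\<^sup>2
        \<le> m $ c * (ln (m $ c) - ln (v $ c))" for c
    proof -
      define t where "t = (m $ c - v $ c) / v $ c"
      have vc: "0 < v $ c" "u \<le> v $ c" using pos u by auto
      have y: "\<bar>m $ c - v $ c\<bar> \<le> \<delta>" using component_le_norm_cart[of "m - v" c] d by simp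
      moreover have "\<delta> \<le> u / 2" by (simp add: \<delta>_def)
      ultimately have mc: "0 < m $ c" using vc u by linarith
      have mt: "m $ c = v $ c * (1 + t)" and yt: "m $ c - v $ c = v $ c * t"
        using vc by (auto simp: t_def field_simps)
      have t1: "-1 < t" using vc mc by (simp add: t_def field_simps)
      have "v $ c * (t + t\<^sup>2 / 2 - t ^ 3 / 6) \<le> v $ c * ((1 + t) * ln (1 + t))"
        using vc entropy_taylor_lower[OF t1] by (intro mult_left_mono) auto
      also have "\<dots> = m $ c * (ln (m $ c) - ln (v $ c))"
        unfolding mt using vc t1 by (simp add: ln_mult)
      finally have 1: "v $ c * t + v $ c * t\<^sup>2 / 2 - v $ c * t ^ 3 / 6 \<le> m $ c * (ln (m $ c) - ln (v $ c))"
        by (simp add: algebra_simps)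
      have "v $ c * t \<le> 6 * e * u\<^sup>2" using y abs_ge_self[of "v $ c * t"] unfolding yt by (simp add: \<delta>_def)
      also have "\<dots> \<le> 6 * e * (v $ c)\<^sup>2" using u vc e by (intro mult_left_mono power_mono) auto
      finally have "t \<le> 6 * e * v $ c" using vc by (simp add: power2_eq_square)
      then have "t * (v $ c * t\<^sup>2) \<le> 6 * e * v $ c * (v $ c * t\<^sup>2)" using vc by (intro mult_right_mono) auto
      then have 2: "v $ c * t ^ 3 / 6 \<le> e * (v $ c * t)\<^sup>2"
        by (simp add: power2_eq_square power3_eq_cube algebra_simps)
      have 3: "(v $ c * t)\<^sup>2 / v $ c = v $ c * t\<^sup>2" using vc by (simp add: power2_eq_square)
      show ?thesis unfolding yt 3 using 1 2 by linarith
    qed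
    have "(\<Sum>c\<in>UNIV. (m $ c - v $ c) + (m $ c - v $ c)\<^sup>2 / v $ c / 2 - e * (m $ c - v $ c)\<^sup>2)
        = (\<Sum>c\<in>UNIV. (m $ c - v $ c)\<^sup>2 / v $ c) / 2 - e * (norm (m - v))\<^sup>2"
      using m v by (simp add: sum.distrib sum_subtractf prob_simplex_def norm_vec_square sum_distrib_left sum_divide_distrib)
    moreover have "(\<Sum>c\<in>UNIV. (m $ c - v $ c) + (m $ c - v $ c)\<^sup>2 / v $ c / 2 - e * (m $ c - v $ c)\<^sup>2)
        \<le> (\<Sum>c\<in>UNIV. m $ c * (ln (m $ c) - ln (v $ c)))"
      by (intro sum_mono summand)
    ultimately show ?thesis by linarith
  qed
  moreover have "0 < \<delta>" using u e by (simp add: \<delta>_def)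
  ultimately show ?thesis by blast
qed

section \<open>The simplex and the free energy in free coordinates\<close>

lemma lift_eq: "lift x = lift 0 + tangent (($) x)"
  by (simp add: lift_def tangent_def vec_eq_iff split: option.split)

lemma linear_tangent: "linear (\<lambda>x. tangent (($) x))"
  by (rule linearI) (auto simp: tangent_def vec_eq_iff sum.distrib sum_distrib_left split: option.split)

lemma has_derivative_lift: "(lift has_derivative (\<lambda>h. tangent (($) h))) F"
proof -
  have "((\<lambda>x. lift 0 + tangent (($) x)) has_derivative (\<lambda>h. 0 + tangent (($) h))) F"
    by (intro has_derivative_add has_derivative_const bounded_linear_imp_has_derivative
        linear_conv_bounded_linear[THEN iffD1] linear_tangent)
  then show ?thesis by (simp flip: lift_eq)
qed

lemma lift_in_simplex: "x \<in> red_simplex \<Longrightarrow> lift x \<in> prob_simplex"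
  by (intro prob_simplexI) (auto simp: lift_def red_simplex_def sum_option split: option.split)

lemma lift_reduce:
  assumes "m \<in> prob_simplex"
  shows "lift (\<chi> i. m $ Some i) = m" "(\<chi> i. m $ Some i) \<in> red_simplex"
proof -
  have s: "m $ None + (\<Sum>i\<in>UNIV. m $ Some i) = 1" and n: "\<And>c. 0 \<le> m $ c" "\<And>c. m $ c \<le> 1"
    using assms by (auto simp: prob_simplex_def sum_option)
  show "lift (\<chi> i. m $ Some i) = m" using s by (auto simp: lift_def vec_eq_iff split: option.split)
  show "(\<chi> i. m $ Some i) \<in> red_simplex" proof -
    have "(\<Sum>i\<in>UNIV. m $ Some i) \<le> 1" using s n(1)[of None] by linarith
    then show ?thesis using n by (simp add: red_simplex_def)
  qed
qed

lemma interior_lift_pos: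
  fixes x :: "real ^ 'n::finite"
  assumes "x \<in> interior red_simplex"
  shows "0 < lift x $ c"
proof -
  obtain e where e: "0 < e" "ball x e \<subseteq> red_simplex" using assms by (auto simp: mem_interior)
  have mem: "x + s *\<^sub>R axis i 1 \<in> red_simplex" if "\<bar>s\<bar> < e" for s i
    using e that by (intro subsetD[OF e(2)]) (simp add: dist_norm)
  show ?thesis
  proof (cases c)
    case (Some i)
    have "x + (- e / 2) *\<^sub>R axis i 1 \<in> red_simplex" using e by (intro mem) simp
    then have "0 \<le> (x + (- e / 2) *\<^sub>R axis i 1) $ i" unfolding red_simplex_def by blast
    with e show ?thesis by (simp add: Some lift_def)
  next
    case None
    fix i :: 'n
    have "x + (e / 2) *\<^sub>R axis i 1 \<in> red_simplex" using e by (intro mem) simp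
    then have "(\<Sum>j\<in>UNIV. (x + (e / 2) *\<^sub>R axis i 1) $ j) \<le> 1" unfolding red_simplex_def by blast
    then have "(\<Sum>j\<in>UNIV. x $ j) + e / 2 * (\<Sum>j\<in>UNIV. axis i 1 $ j) \<le> 1"
      by (simp add: sum.distrib sum_distrib_left)
    moreover have "(\<Sum>j\<in>UNIV. axis i (1::real) $ j) = 1" by (simp add: axis_def)
    ultimately show ?thesis using e by (simp add: None lift_def)
  qed
qed

text \<open>\<open>C2_on\<close> supplies derivatives within the simplex, which has empty interior.
  Composition with \<open>lift\<close> turns them into ordinary derivatives at interior points of
  \<open>red_simplex\<close>.\<close>

lemma free_energy_differentiable:
  fixes F :: "real ^ ('n::finite option) \<Rightarrow> real" and x :: "real ^ 'n"
  assumes "C2_on prob_simplex F" and x: "x \<in> interior red_simplex"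
  shows "free_energy F differentiable (at x)" "partial_deriv j (free_energy F) differentiable (at x)"
proof -
  obtain f' :: "(real ^ 'n option) \<Rightarrow> (real ^ 'n option) \<Rightarrow>\<^sub>L real"
    and f'' :: "(real ^ 'n option) \<Rightarrow> (real ^ 'n option) \<Rightarrow>\<^sub>L ((real ^ 'n option) \<Rightarrow>\<^sub>L real)"
    where f': "\<And>m. m \<in> prob_simplex \<Longrightarrow> (F has_derivative blinfun_apply (f' m)) (at m within prob_simplex)"
    and f'': "\<And>m. m \<in> prob_simplex \<Longrightarrow> (f' has_derivative blinfun_apply (f'' m)) (at m within prob_simplex)"
    using assms(1) unfolding C2_on_def by blast
  let ?T = "\<lambda>h :: real ^ 'n. tangent (($) h)"
  \<comment> \<open>Differentiating \<open>m * ln m\<close> gives \<open>1 + ln m\<close>; the 1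
    disappears on summation because tangent vectors have total 0.\<close>
  define D where "D y h = blinfun_apply (f' (lift y)) (?T h) - (\<Sum>c\<in>UNIV. ?T h $ c * ln (lift y $ c))"
    for y h :: "real ^ 'n"
  have comp: "((\<lambda>y. g (lift y)) has_derivative (\<lambda>h. g' (?T h))) (at y)"
    if "y \<in> interior red_simplex" "(g has_derivative g') (at (lift y) within prob_simplex)"
    for g :: "(real ^ 'n option) \<Rightarrow> 'b::real_normed_vector" and g' y
  proof -
    have "((\<lambda>y. g (lift y)) has_derivative (\<lambda>h. g' (?T h))) (at y within red_simplex)"
      by (rule has_derivative_in_compose[OF has_derivative_lift])
        (rule has_derivative_subset[OF that(2)], use lift_in_simplex in auto)
    then show ?thesis using at_within_interior[OF that(1)] by simp
  qed
  have coord: "((\<lambda>y. lift y $ c) has_derivative (\<lambda>h. ?T h $ c)) (at y)" for y c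
    using has_derivative_lift by (rule bounded_linear.has_derivative[OF bounded_linear_vec_nth])
  have lnd: "((\<lambda>y. ln (lift y $ c)) has_derivative (\<lambda>h. inverse (lift y $ c) * ?T h $ c)) (at y)"
    if "y \<in> interior red_simplex" for y c
    using DERIV_compose_FDERIV[OF DERIV_ln[OF interior_lift_pos[OF that]] coord]
    by (simp add: mult.commute)
  have deriv: "(free_energy F has_derivative D y) (at y)" if y: "y \<in> interior red_simplex" for y
  proof -
    have pos: "0 < lift y $ c" for c using interior_lift_pos[OF y] .
    have "((\<lambda>y. F (lift y)) has_derivative (\<lambda>h. f' (lift y) (?T h))) (at y)"
      using y interior_subset by (intro comp f' lift_in_simplex) auto
    moreover have "((\<lambda>y. ent (lift y)) has_derivative
        (\<lambda>h. - (\<Sum>c\<in>UNIV. lift y $ c * (inverse (lift y $ c) * ?T h $ c) + ?T h $ c * ln (lift y $ c)))) (at y)"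
      unfolding ent_def by (intro has_derivative_minus has_derivative_sum has_derivative_mult coord lnd y)
    ultimately have "((\<lambda>y. F (lift y) + ent (lift y)) has_derivative (\<lambda>h. f' (lift y) (?T h) +
        - (\<Sum>c\<in>UNIV. lift y $ c * (inverse (lift y $ c) * ?T h $ c) + ?T h $ c * ln (lift y $ c)))) (at y)"
      by (rule has_derivative_add)
    moreover have "f' (lift y) (?T h) +
        - (\<Sum>c\<in>UNIV. lift y $ c * (inverse (lift y $ c) * ?T h $ c) + ?T h $ c * ln (lift y $ c)) = D y h" for h
    proof -
      have cancel: "lift y $ c * (inverse (lift y $ c) * ?T h $ c) = ?T h $ c" for c
        using pos[of c] by simp
      show ?thesis
        by (simp only: D_def sum.distrib cancel sum_tangent add_0_left add_uminus_conv_diff)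
    qed
    ultimately show ?thesis by (simp add: free_energy_def[abs_def])
  qed
  show "free_energy F differentiable (at x)" using deriv[OF x] by (rule differentiableI)
  have pd: "partial_deriv j (free_energy F) y = D y (axis j 1)" if "y \<in> interior red_simplex" for y
    by (simp add: partial_deriv_def flip: frechet_derivative_at[OF deriv[OF that]])
  have "(\<lambda>y. D y (axis j 1)) differentiable (at x)"
  proof -
    have "((\<lambda>y. f' (lift y)) has_derivative (\<lambda>h. f'' (lift x) (?T h))) (at x)"
      using x interior_subset by (intro comp f'' lift_in_simplex) auto
    then have "((\<lambda>y. blinfun_apply (f' (lift y)) (?T (axis j 1))) has_derivative
        (\<lambda>h. blinfun_apply (f'' (lift x) (?T h)) (?T (axis j 1)))) (at x)"
      by (rule bounded_linear.has_derivative[OF blinfun.bounded_linear_left])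
    moreover have "((\<lambda>y. \<Sum>c\<in>UNIV. ?T (axis j 1) $ c * ln (lift y $ c)) has_derivative
        (\<lambda>h. \<Sum>c\<in>UNIV. ?T (axis j 1) $ c * (inverse (lift x $ c) * ?T h $ c))) (at x)"
      by (intro has_derivative_sum has_derivative_mult_right lnd x)
    ultimately show ?thesis unfolding D_def by (rule differentiableI[OF has_derivative_diff])
  qed
  then obtain D2 where "((\<lambda>y. D y (axis j 1)) has_derivative D2) (at x)" by (auto simp: differentiable_def)
  then have "(partial_deriv j (free_energy F) has_derivative D2) (at x)"
    by (rule has_derivative_transform_within_open[OF _ open_interior x]) (simp add: pd)
  then show "partial_deriv j (free_energy F) differentiable (at x)" by (rule differentiableI)
qed

lemma free_energy_expansion:
  fixes F :: "real ^ ('n::finite option) \<Rightarrow> real" and x :: "real ^ 'n"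
  assumes C2: "C2_on prob_simplex F" and x: "x \<in> interior red_simplex"
    and max: "x \<in> maximizers (free_energy F)" and e: "0 < e"
  shows "\<exists>\<delta>>0. \<forall>h. norm h \<le> \<delta> \<longrightarrow>
    \<bar>free_energy F (x + h) - free_energy F x + (h \<bullet> (H_mat F x *v h)) / 2\<bar> \<le> e * (norm h)\<^sup>2"
proof -
  have crit: "partial_deriv j (free_energy F) x = 0" for j
  proof -
    have "\<forall>y\<in>interior red_simplex. free_energy F y \<le> free_energy F x"
      using max interior_subset by (auto simp: maximizers_def)
    moreover have "(free_energy F has_derivative frechet_derivative (free_energy F) (at x)) (at x)"
      using free_energy_differentiable(1)[OF C2 x] by (simp add: frechet_derivative_works)
    ultimately have "frechet_derivative (free_energy F) (at x) = (\<lambda>v. 0)"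
      using differential_zero_maxmin[OF x open_interior] by blast
    then show ?thesis by (simp add: partial_deriv_def)
  qed
  have "\<exists>\<delta>>0. \<forall>h. norm h \<le> \<delta> \<longrightarrow> \<bar>free_energy F (x + h) - free_energy F x
      - (h \<bullet> (hessian (free_energy F) x *v h)) / 2\<bar> \<le> e * (norm h)\<^sup>2"
    using free_energy_differentiable[OF C2] x crit e
    by (intro second_order_expansion[of "interior red_simplex"]) auto
  moreover have "h \<bullet> (H_mat F x *v h) = - (h \<bullet> (hessian (free_energy F) x *v h))" for h
    by (simp add: H_mat_def matrix_vector_mult_def inner_vec_def sum_negf)
  ultimately show ?thesis by simp
qed

section \<open>Comparison of Hessian and Fisher information, and its consequences\<close>

lemma pos_def_invertible:
  fixes A :: "real ^ 'n::finite ^ 'n"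
  assumes "pos_def A" shows "invertible A"
proof -
  have "x = 0" if "A *v x = 0" for x
    using assms that unfolding pos_def_def by (metis inner_zero_right less_irrefl)
  then show ?thesis
    by (simp add: invertible_left_inverse matrix_left_invertible_ker)
qed

lemma matrix_inv_mult_left: "invertible A \<Longrightarrow> matrix_inv A ** A = mat 1"
  unfolding matrix_inv_def invertible_def by (rule someI2_ex) auto

text \<open>The matrix \<open>V = diag x - x x\<^sup>T\<close> has inverse quadratic form \<open>Q\<close>, so \<open>V < H\<inverse>\<close> turns into
  \<open>H < Q\<close> by Cauchy--Schwarz.\<close>

lemma hessian_less_fisher_information:
  fixes F :: "real ^ ('n::finite option) \<Rightarrow> real" and x h :: "real ^ 'n"
  assumes pos: "\<And>c. 0 < lift x $ c" and H: "pos_def (H_mat F x)" and \<Sigma>: "pos_def (Sigma_mat F x)"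
    and h: "h \<noteq> 0"
  shows "h \<bullet> (H_mat F x *v h) < (\<Sum>c\<in>UNIV. (tangent (($) h) $ c)\<^sup>2 / lift x $ c)"
proof -
  define v where "v = lift x"
  define T where "T c = tangent (($) h) $ c" for c
  \<comment> \<open>Evaluated at \<open>z\<close>, the inverse matrix in \<open>Sigma_mat\<close>
    contributes \<open>q\<close>. The rest is minus \<open>W\<close>, the variance under
    \<open>v\<close> of \<open>zc\<close>, which extends \<open>z\<close> by 0 to the last colour.
    Positivity thus says \<open>W < q\<close>.\<close>
  define z where "z = H_mat F x *v h"
  define zc where "zc c = (case c of Some i \<Rightarrow> z $ i | None \<Rightarrow> 0)" for c
  define zb where "zb = (\<Sum>i\<in>UNIV. x $ i * z $ i)"
  define q where "q = h \<bullet> z"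
  define Q where "Q = (\<Sum>c\<in>UNIV. (T c)\<^sup>2 / v $ c)"
  define W where "W = (\<Sum>c\<in>UNIV. v $ c * (zc c - zb)\<^sup>2)"
  have v: "0 < v $ c" for c using pos by (simp add: v_def)
  have vsum: "(\<Sum>c\<in>UNIV. v $ c) = 1" by (simp add: v_def lift_def sum_option)
  have q0: "0 < q" using H h by (simp add: pos_def_def q_def z_def)
  then have z0: "z \<noteq> 0" by (auto simp: q_def)
  have inv: "matrix_inv (H_mat F x) *v z = h"
    using matrix_inv_mult_left[OF pos_def_invertible[OF H]] by (simp add: z_def matrix_vector_mul_assoc)
  have zbc: "(\<Sum>c\<in>UNIV. v $ c * zc c) = zb"
    by (simp add: zc_def zb_def sum_option v_def lift_def)
  have "W = (\<Sum>c\<in>UNIV. v $ c * (zc c)\<^sup>2 - 2 * zb * (v $ c * zc c) + zb\<^sup>2 * v $ c)"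
    unfolding W_def by (intro sum.cong refl) (simp add: power2_eq_square algebra_simps)
  also have "\<dots> = (\<Sum>c\<in>UNIV. v $ c * (zc c)\<^sup>2) - 2 * zb * zb + zb\<^sup>2 * 1"
    by (simp only: sum.distrib sum_subtractf sum_distrib_left[symmetric] zbc vsum)
  also have "\<dots> = (\<Sum>i\<in>UNIV. x $ i * (z $ i)\<^sup>2) - zb\<^sup>2"
    by (simp add: zc_def sum_option v_def lift_def power2_eq_square)
  finally have W: "W = (\<Sum>i\<in>UNIV. x $ i * (z $ i)\<^sup>2) - zb\<^sup>2" .
  have "z \<bullet> (Sigma_mat F x *v z) = q - W"
  proof -
    have "((\<chi> a b. if a = b then x $ a else 0) *v z) $ i = x $ i * z $ i" for i
      by (simp add: matrix_vector_mult_def if_distrib if_distribR cong: if_cong)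
    then have 1: "z \<bullet> ((\<chi> a b. if a = b then x $ a else 0) *v z) = (\<Sum>i\<in>UNIV. x $ i * (z $ i)\<^sup>2)"
      by (simp add: inner_vec_def power2_eq_square mult_ac)
    have "((\<chi> a b. x $ a * x $ b) *v z) $ i = x $ i * zb" for i
      by (simp add: matrix_vector_mult_def zb_def sum_distrib_left mult_ac)
    then have "z \<bullet> ((\<chi> a b. x $ a * x $ b) *v z) = (\<Sum>i\<in>UNIV. x $ i * z $ i) * zb"
      by (simp add: inner_vec_def sum_distrib_left sum_distrib_right mult_ac)
    then have 2: "z \<bullet> ((\<chi> a b. x $ a * x $ b) *v z) = zb\<^sup>2"
      by (simp add: zb_def power2_eq_square)
    show ?thesis unfolding Sigma_mat_def W q_def
      by (simp add: matrix_vector_mult_add_rdistrib matrix_vector_mult_diff_rdistrib inner_add_right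
          inner_diff_right 1 2 inv inner_commute)
  qed
  with \<Sigma> z0 have Wq: "W < q" by (force simp: pos_def_def)
  have Tsum: "(\<Sum>c\<in>UNIV. T c) = 0" by (simp add: T_def sum_tangent)
  have "q = (\<Sum>c\<in>UNIV. T c * zc c)"
    by (simp add: q_def T_def zc_def sum_option tangent_def inner_vec_def)
  \<comment> \<open>Centring is free because \<open>T\<close> has total 0, and it turns the second
    Cauchy-Schwarz factor into \<open>W\<close>. The result is
    \<open>q * q \<le> Q * W < Q * q\<close>.\<close>
  also have "\<dots> = (\<Sum>c\<in>UNIV. T c * (zc c - zb))"
    by (simp add: right_diff_distrib sum_subtractf Tsum flip: sum_distrib_right)
  also have "\<dots> = (\<Sum>c\<in>UNIV. (T c / sqrt (v $ c)) * (sqrt (v $ c) * (zc c - zb)))"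
    using v by (intro sum.cong refl) (simp add: less_imp_neq[symmetric])
  finally have "q\<^sup>2 \<le> (\<Sum>c\<in>UNIV. (T c / sqrt (v $ c))\<^sup>2) * (\<Sum>c\<in>UNIV. (sqrt (v $ c) * (zc c - zb))\<^sup>2)"
    using Cauchy_Schwarz_ineq_sum by metis
  also have "\<dots> = Q * W"
    using v by (simp add: Q_def W_def power_divide power_mult_distrib less_imp_le)
  finally have qq: "q * q \<le> Q * W" by (simp add: power2_eq_square)
  have "0 \<le> Q" unfolding Q_def using v by (intro sum_nonneg) (simp add: less_imp_le)
  moreover have "Q \<noteq> 0"
  proof
    assume "Q = 0"
    with qq have "q * q \<le> 0" by simp
    with mult_pos_pos[OF q0 q0] show False by linarith
  qed
  ultimately have "0 < Q" by simp
  with Wq have "Q * W < Q * q" by simp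
  with qq have "q * q < Q * q" by linarith
  with q0 have "q < Q" by simp
  then show ?thesis by (simp add: q_def z_def Q_def T_def v_def)
qed

text \<open>The last coordinate of a tangent vector is minus the sum of the others, so
  Cauchy-Schwarz makes the two norms equivalent; estimates in \<open>h\<close> transfer to
  \<open>m - lift x\<close>.\<close>

lemma simplex_diff_lift:
  fixes x :: "real ^ 'n::finite"
  assumes m: "m \<in> prob_simplex"
  defines "h \<equiv> (\<chi> i. m $ Some i) - x"
  shows "lift (x + h) = m" "m - lift x = tangent (($) h)" "norm h \<le> norm (m - lift x)"
    "(norm (m - lift x))\<^sup>2 \<le> (1 + real CARD('n)) * (norm h)\<^sup>2"
proof -
  show 1: "lift (x + h) = m" using lift_reduce(1)[OF m] by (simp add: h_def)
  show 2: "m - lift x = tangent (($) h)"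
    by (simp flip: 1) (simp add: lift_def tangent_def vec_eq_iff sum.distrib split: option.split)
  have nrm: "(norm (m - lift x))\<^sup>2 = (\<Sum>i\<in>UNIV. h $ i)\<^sup>2 + (norm h)\<^sup>2"
    unfolding 2 by (simp add: norm_vec_square sum_option) (simp add: tangent_def)
  then have "(norm h)\<^sup>2 \<le> (norm (m - lift x))\<^sup>2" by simp
  then show "norm h \<le> norm (m - lift x)" by (rule power2_le_imp_le) simp
  have "(\<Sum>i\<in>UNIV. h $ i)\<^sup>2 \<le> real CARD('n) * (norm h)\<^sup>2"
    using Cauchy_Schwarz_ineq_sum[of "\<lambda>_. 1" "\<lambda>i. h $ i" UNIV] by (simp add: norm_vec_square)
  with nrm show "(norm (m - lift x))\<^sup>2 \<le> (1 + real CARD('n)) * (norm h)\<^sup>2" by (simp add: distrib_right)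
qed

lemma quadratic_form_scale:
  fixes A :: "real ^ 'n::finite ^ 'n"
  shows "(s *\<^sub>R h) \<bullet> (A *v (s *\<^sub>R h)) = s\<^sup>2 * (h \<bullet> (A *v h))"
  by (simp add: matrix_vector_mult_scaleR power2_eq_square)

lemma continuous_on_quadratic_form:
  fixes A :: "real ^ 'n::finite ^ 'n"
  shows "continuous_on UNIV (\<lambda>h. h \<bullet> (A *v h))"
  by (intro continuous_intros matrix_vector_mult_linear_continuous_on)

lemma free_energy_upper:
  fixes F :: "real ^ ('n::finite option) \<Rightarrow> real" and x :: "real ^ 'n"
  assumes C2: "C2_on prob_simplex F" and x: "x \<in> interior red_simplex"
    and max: "x \<in> maximizers (free_energy F)" and H: "pos_def (H_mat F x)"
  shows "\<exists>c>0. \<exists>\<delta>>0. \<forall>m\<in>prob_simplex. norm (m - lift x) \<le> \<delta> \<longrightarrow>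
    F m + ent m \<le> free_energy F x - c * (norm (m - lift x))\<^sup>2"
proof -
  obtain b where b: "0 < b" "\<And>h. b * (norm h)\<^sup>2 \<le> h \<bullet> (H_mat F x *v h)"
    using square_homogeneous_coercive[of "\<lambda>h. h \<bullet> (H_mat F x *v h)", OF continuous_on_quadratic_form quadratic_form_scale] H
    by (auto simp: pos_def_def)
  \<comment> \<open>Half of the quadratic decrease \<open>b / 2\<close> pays for the Taylor
    remainder.\<close>
  obtain \<delta> where \<delta>: "0 < \<delta>" "\<And>h. norm h \<le> \<delta> \<Longrightarrow>
      \<bar>free_energy F (x + h) - free_energy F x + (h \<bullet> (H_mat F x *v h)) / 2\<bar> \<le> b / 4 * (norm h)\<^sup>2"
    using free_energy_expansion[OF C2 x max, of "b / 4"] b by auto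
  define n where "n = real CARD('n)"
  have "F m + ent m \<le> free_energy F x - b / (4 * (1 + n)) * (norm (m - lift x))\<^sup>2"
    if m: "m \<in> prob_simplex" "norm (m - lift x) \<le> \<delta>" for m
  proof -
    define h where "h = (\<chi> i. m $ Some i) - x"
    note hm = simplex_diff_lift[OF m(1), of x, folded h_def n_def]
    have "free_energy F (x + h) \<le> free_energy F x - b / 4 * (norm h)\<^sup>2"
    proof -
      have "\<bar>free_energy F (x + h) - free_energy F x + (h \<bullet> (H_mat F x *v h)) / 2\<bar> \<le> b / 4 * (norm h)\<^sup>2"
        using hm(3) m(2) by (intro \<delta>(2)) simp
      then show ?thesis using b(2)[of h] by linarith
    qed
    moreover have "b / (4 * (1 + n)) * (norm (m - lift x))\<^sup>2 \<le> b / (4 * (1 + n)) * ((1 + n) * (norm h)\<^sup>2)"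
      using hm(4) b by (intro mult_left_mono) (auto simp: n_def)
    moreover have "b / (4 * (1 + n)) * ((1 + n) * (norm h)\<^sup>2) = b / 4 * (norm h)\<^sup>2"
    proof -
      have "1 + n \<noteq> 0" by (simp add: n_def add_nonneg_eq_0_iff)
      then show ?thesis by (simp add: divide_simps)
    qed
    moreover have "free_energy F (x + h) = F m + ent m" by (simp add: free_energy_def hm(1))
    ultimately show ?thesis by linarith
  qed
  moreover have "0 < b / (4 * (1 + n))" using b by (simp add: n_def add_pos_nonneg)
  ultimately show ?thesis using \<delta>(1) by blast
qed

text \<open>The right side is \<open>F m + ent m\<close> plus the relative entropy of
  \<open>m\<close> with respect to \<open>lift x\<close>. To second order the former loses half the
  form of \<open>H_mat\<close> and the latter gains half the Fisher form, which is larger.\<close>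

lemma free_energy_lower:
  fixes F :: "real ^ ('n::finite option) \<Rightarrow> real" and x :: "real ^ 'n"
  assumes C2: "C2_on prob_simplex F" and x: "x \<in> interior red_simplex"
    and max: "x \<in> maximizers (free_energy F)"
    and H: "pos_def (H_mat F x)" and \<Sigma>: "pos_def (Sigma_mat F x)"
  shows "\<exists>b>0. \<exists>\<delta>>0. \<forall>m\<in>prob_simplex. norm (m - lift x) \<le> \<delta> \<longrightarrow>
    free_energy F x + b * (norm (m - lift x))\<^sup>2 \<le> F m - (\<Sum>c\<in>UNIV. m $ c * ln (lift x $ c))"
proof -
  define n where "n = real CARD('n)"
  have n: "0 < 1 + n" by (simp add: n_def add_pos_nonneg)
  have pos: "0 < lift x $ c" for c by (rule interior_lift_pos[OF x])
  have v: "lift x \<in> prob_simplex" using x interior_subset by (intro lift_in_simplex) auto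
  define Q where "Q h = (\<Sum>c\<in>UNIV. (tangent (($) h) $ c)\<^sup>2 / lift x $ c)" for h :: "real ^ 'n"
  have lin: "linear (\<lambda>h :: real ^ 'n. tangent (($) h))" by (rule linear_tangent)
  have contT: "continuous_on UNIV (\<lambda>h :: real ^ 'n. tangent (($) h))"
    using linear_continuous_on linear_conv_bounded_linear[THEN iffD1, OF lin] by blast
  have "\<exists>b>0. \<forall>h. b * (norm h)\<^sup>2 \<le> Q h - h \<bullet> (H_mat F x *v h)"
  proof (rule square_homogeneous_coercive)
    show "continuous_on UNIV (\<lambda>h. Q h - h \<bullet> (H_mat F x *v h))"
      unfolding Q_def using pos
      by (intro continuous_on_diff continuous_on_quadratic_form continuous_on_sum continuous_on_divide
          continuous_on_power continuous_on_const continuous_on_component contT) (auto simp: less_imp_neq[symmetric])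
    show "Q (s *\<^sub>R h) - (s *\<^sub>R h) \<bullet> (H_mat F x *v (s *\<^sub>R h)) = s\<^sup>2 * (Q h - h \<bullet> (H_mat F x *v h))" for s h
      unfolding quadratic_form_scale Q_def linear_cmul[OF lin]
      by (simp add: power_mult_distrib right_diff_distrib sum_distrib_left)
    show "0 < Q h - h \<bullet> (H_mat F x *v h)" if "h \<noteq> 0" for h
      using hessian_less_fisher_information[OF pos H \<Sigma> that] by (simp add: Q_def)
  qed
  then obtain b where b: "0 < b" "\<And>h. b * (norm h)\<^sup>2 \<le> Q h - h \<bullet> (H_mat F x *v h)" by blast
  \<comment> \<open>The curvature \<open>b / 2\<close> has to cover three terms of at most
    \<open>b / 8\<close>: the two remainders and the claimed gain. The factor \<open>1 + n\<close>
    converts the norms.\<close>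
  define e where "e = b / (8 * (1 + n))"
  have e: "0 < e" using b n by (simp add: e_def)
  obtain \<delta>1 where \<delta>1: "0 < \<delta>1" "\<And>h. norm h \<le> \<delta>1 \<Longrightarrow>
      \<bar>free_energy F (x + h) - free_energy F x + (h \<bullet> (H_mat F x *v h)) / 2\<bar> \<le> b / 8 * (norm h)\<^sup>2"
    using free_energy_expansion[OF C2 x max, of "b / 8"] b by auto
  obtain \<delta>2 where \<delta>2: "0 < \<delta>2" "\<And>m. m \<in> prob_simplex \<Longrightarrow> norm (m - lift x) \<le> \<delta>2 \<Longrightarrow>
    (\<Sum>c\<in>UNIV. (m $ c - lift x $ c)\<^sup>2 / lift x $ c) / 2 - e * (norm (m - lift x))\<^sup>2
      \<le> (\<Sum>c\<in>UNIV. m $ c * (ln (m $ c) - ln (lift x $ c)))"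
    using relative_entropy_quadratic_lower[OF v pos e] by blast
  have "free_energy F x + e * (norm (m - lift x))\<^sup>2 \<le> F m - (\<Sum>c\<in>UNIV. m $ c * ln (lift x $ c))"
    if m: "m \<in> prob_simplex" "norm (m - lift x) \<le> min \<delta>1 \<delta>2" for m
  proof -
    define h where "h = (\<chi> i. m $ Some i) - x"
    note hm = simplex_diff_lift[OF m(1), of x, folded h_def n_def]
    have 1: "free_energy F x - (h \<bullet> (H_mat F x *v h)) / 2 - b / 8 * (norm h)\<^sup>2 \<le> F m + ent m"
    proof -
      have "\<bar>free_energy F (x + h) - free_energy F x + (h \<bullet> (H_mat F x *v h)) / 2\<bar> \<le> b / 8 * (norm h)\<^sup>2"
        using hm(3) m(2) by (intro \<delta>1(2)) simp
      moreover have "free_energy F (x + h) = F m + ent m" by (simp add: free_energy_def hm(1))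
      ultimately show ?thesis by linarith
    qed
    have "(\<Sum>c\<in>UNIV. (m $ c - lift x $ c)\<^sup>2 / lift x $ c) = Q h"
      unfolding Q_def hm(2)[symmetric] by simp
    then have 2: "Q h / 2 - e * (norm (m - lift x))\<^sup>2 \<le> (\<Sum>c\<in>UNIV. m $ c * (ln (m $ c) - ln (lift x $ c)))"
      using \<delta>2(2)[OF m(1)] m(2) by simp
    have 3: "(\<Sum>c\<in>UNIV. m $ c * (ln (m $ c) - ln (lift x $ c))) = - ent m - (\<Sum>c\<in>UNIV. m $ c * ln (lift x $ c))"
      by (simp add: ent_def right_diff_distrib sum_subtractf)
    have "e * (norm (m - lift x))\<^sup>2 \<le> e * ((1 + n) * (norm h)\<^sup>2)"
      using hm(4) e by (intro mult_left_mono) auto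
    also have "\<dots> = b / 8 * (norm h)\<^sup>2" using n by (simp add: e_def divide_simps)
    finally have 4: "e * (norm (m - lift x))\<^sup>2 \<le> b / 8 * (norm h)\<^sup>2" .
    have 5: "0 \<le> b * (norm h)\<^sup>2" using b by simp
    show ?thesis using 1 2 3 4 5 b(2)[of h] by linarith
  qed
  moreover have "0 < min \<delta>1 \<delta>2" using \<delta>1(1) \<delta>2(1) by simp
  ultimately show ?thesis using e by blast
qed

section \<open>Compactness and the gap of the free energy\<close>

lemma continuous_on_ent: "continuous_on prob_simplex ent"
proof -
  have xlx: "continuous_on {0..} (\<lambda>x::real. x * ln x)"
    unfolding continuous_on_eq_continuous_within
  proof
    fix x :: real assume x: "x \<in> {0..}"
    show "continuous (at x within {0..}) (\<lambda>x. x * ln x)"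
    proof (cases "x = 0")
      case True
      have "((\<lambda>x::real. x * ln x) \<longlongrightarrow> 0) (at_right 0)" by real_asymp
      then have "((\<lambda>x::real. x * ln x) \<longlongrightarrow> 0) (at 0 within {0..})"
        using at_within_Ici_at_right[of "0::real"] by simp
      with True show ?thesis by (simp add: continuous_within)
    next
      case False
      then show ?thesis by (intro continuous_intros) auto
    qed
  qed
  show ?thesis unfolding ent_def
  proof (intro continuous_on_minus continuous_on_sum)
    fix c :: 'a
    show "continuous_on prob_simplex (\<lambda>m. m $ c * ln (m $ c))"
      by (rule continuous_on_compose2[OF xlx]) (auto simp: prob_simplex_def intro!: continuous_intros)
  qed
qed

lemma compact_prob_simplex: "compact (prob_simplex :: (real ^ 'c::finite) set)"
proof -
  have "prob_simplex = cbox 0 1 \<inter> {m :: real ^ 'c. (\<Sum>c\<in>UNIV. m $ c) = 1}"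
    by (auto simp: prob_simplex_def mem_box_cart)
  moreover have "closed {m :: real ^ 'c. (\<Sum>c\<in>UNIV. m $ c) = 1}"
    by (intro closed_Collect_eq continuous_intros)
  ultimately show ?thesis using compact_Int_closed[OF compact_cbox] by metis
qed

lemma continuous_on_C2: "C2_on S f \<Longrightarrow> continuous_on S f"
  unfolding C2_on_def continuous_on_eq_continuous_within by (blast intro: has_derivative_continuous)

text \<open>Off \<open>U\<close> the supremum is attained by compactness, at a point that is not a
  maximizer; its deficit is the gap.\<close>

lemma free_energy_gap:
  fixes F :: "real ^ ('n::finite option) \<Rightarrow> real"
  assumes C2: "C2_on prob_simplex F" and x: "x \<in> maximizers (free_energy F)"
    and U: "open U" "lift ` maximizers (free_energy F) \<subseteq> U"
  shows "\<exists>\<eta>>0. \<forall>m\<in>prob_simplex - U. F m + ent m \<le> free_energy F x - \<eta>"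
proof (cases "prob_simplex - U = {}")
  case True
  then show ?thesis by (intro exI[of _ 1]) (metis empty_iff zero_less_one)
next
  case False
  have "compact (prob_simplex - U)" using compact_diff[OF compact_prob_simplex U(1)] .
  moreover have "continuous_on (prob_simplex - U) (\<lambda>m. F m + ent m)"
    by (intro continuous_on_add continuous_on_subset[OF continuous_on_C2[OF C2]]
        continuous_on_subset[OF continuous_on_ent]) auto
  ultimately obtain m0 where m0: "m0 \<in> prob_simplex - U"
      "\<And>m. m \<in> prob_simplex - U \<Longrightarrow> F m + ent m \<le> F m0 + ent m0"
    using continuous_attains_sup[OF _ False] by blast
  define y where "y = (\<chi> i. m0 $ Some i)"
  have y: "lift y = m0" "y \<in> red_simplex" using lift_reduce[of m0] m0(1) by (auto simp: y_def)
  have "y \<notin> maximizers (free_energy F)" using U(2) y m0(1) by auto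
  then obtain y' where "y' \<in> red_simplex" "free_energy F y < free_energy F y'"
    using y(2) by (auto simp: maximizers_def not_le)
  with x have "free_energy F y < free_energy F x" by (force simp: maximizers_def)
  then have "F m0 + ent m0 < free_energy F x" by (simp add: free_energy_def y)
  then show ?thesis
    using m0(2) by (intro exI[of _ "free_energy F x - (F m0 + ent m0)"]) auto
qed

section \<open>The lower bound on the relative entropy\<close>

text \<open>The log-likelihood ratio is \<open>N * L (emp N \<sigma>)\<close>, and
  \<open>L v\<close> is minus the relative entropy of \<open>v\<close> with respect to
  \<open>w\<close>, hence negative. Continuity keeps \<open>L\<close> negative on a ball whose
  radius is independent of \<open>N\<close>.\<close>

lemma prodw_le_near:
  fixes v w :: "real ^ 'c::finite"
  assumes v: "v \<in> prob_simplex" "\<And>c. 0 < v $ c" and w: "w \<in> prob_simplex" "\<And>c. 0 < w $ c"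
    and "w \<noteq> v"
  shows "\<exists>\<delta>>0. \<forall>N \<sigma>. norm (emp N \<sigma> - v) < \<delta> \<longrightarrow> prodw N w \<sigma> \<le> prodw N v \<sigma>"
proof -
  define L where "L m = (\<Sum>c\<in>UNIV. m $ c * (ln (w $ c) - ln (v $ c)))" for m :: "real ^ 'c"
  have ln_bound: "v $ c * (ln (w $ c) - ln (v $ c)) \<le> w $ c - v $ c"
    "w $ c \<noteq> v $ c \<Longrightarrow> v $ c * (ln (w $ c) - ln (v $ c)) < w $ c - v $ c" for c
  proof -
    have pos: "0 < w $ c" "0 < v $ c" using v w by auto
    have 1: "ln (w $ c) - ln (v $ c) = ln (w $ c / v $ c)" using pos by (simp add: ln_div)
    have 2: "w $ c - v $ c = v $ c * (w $ c / v $ c - 1)" using pos by (simp add: field_simps)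
    have le: "ln (w $ c / v $ c) \<le> w $ c / v $ c - 1" using pos by (intro ln_le_minus_one) simp
    then show "v $ c * (ln (w $ c) - ln (v $ c)) \<le> w $ c - v $ c"
      unfolding 1 2 using pos by (intro mult_left_mono) auto
    assume "w $ c \<noteq> v $ c"
    then have "ln (w $ c / v $ c) \<noteq> w $ c / v $ c - 1"
      using ln_eq_minus_one[of "w $ c / v $ c"] pos by auto
    with le show "v $ c * (ln (w $ c) - ln (v $ c)) < w $ c - v $ c"
      unfolding 1 2 using pos by (intro mult_strict_left_mono) auto
  qed
  have "L v < (\<Sum>c\<in>UNIV. w $ c - v $ c)"
    unfolding L_def using ln_bound \<open>w \<noteq> v\<close>
    by (intro sum_strict_mono_ex1) (auto simp: vec_eq_iff)
  also have "\<dots> = 0" using v w by (simp add: sum_subtractf prob_simplex_def)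
  finally have "L v < 0" .
  moreover have "continuous (at v) L" unfolding L_def by (intro continuous_intros)
  ultimately have "\<forall>\<^sub>F m in at v. L m < 0" by (simp add: continuous_at order_tendstoD(2))
  then obtain \<delta> where \<delta>: "0 < \<delta>" "\<And>m. m \<noteq> v \<Longrightarrow> dist m v < \<delta> \<Longrightarrow> L m < 0"
    by (auto simp: eventually_at)
  have "prodw N w \<sigma> \<le> prodw N v \<sigma>" if "norm (emp N \<sigma> - v) < \<delta>" for N \<sigma>
  proof -
    have "L (emp N \<sigma>) < 0"
      using that \<delta>(2)[of "emp N \<sigma>"] \<open>L v < 0\<close> by (cases "emp N \<sigma> = v") (auto simp: dist_norm)
    then have "real N * L (emp N \<sigma>) \<le> 0" by (simp add: mult_nonneg_nonpos)
    moreover have "real N * L (emp N \<sigma>) = (\<Sum>c\<in>UNIV. counts N \<sigma> $ c * ln (w $ c)) - (\<Sum>c\<in>UNIV. counts N \<sigma> $ c * ln (v $ c))"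
      by (simp add: L_def counts_eq_emp sum_distrib_left algebra_simps flip: sum_subtractf)
    ultimately show ?thesis by (simp add: prodw_eq_exp v w)
  qed
  with \<delta>(1) show ?thesis by blast
qed

text \<open>Only completions typical for \<open>v\<close> are kept. They have product mass at least
  1 / 2, whence the 2 in \<open>2 * C\<close>, and the gain \<open>K\<close> in the exponent applies
  to each of them.\<close>

lemma marginal_weight_lower:
  fixes F :: "real ^ 'c::finite \<Rightarrow> real"
  assumes v: "v \<in> prob_simplex" "\<And>c. 0 < v $ c" and N: "1 \<le> N" "k \<le> N" and \<tau>: "\<tau> \<in> configs k"
    and b: "\<And>m. m \<in> prob_simplex \<Longrightarrow> norm (m - v) \<le> \<delta> \<Longrightarrow>
      g + b * (norm (m - v))\<^sup>2 \<le> F m - (\<Sum>c\<in>UNIV. m $ c * ln (v $ c))"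
    and near: "\<And>\<tau>'. \<tau>' \<in> typical (N - k) v \<Longrightarrow> norm (emp N (append_config k (N - k) \<tau> \<tau>') - v) \<le> \<delta>"
    and away: "\<And>\<tau>'. \<tau>' \<in> typical (N - k) v \<Longrightarrow>
      K \<le> real N * b * (norm (emp N (append_config k (N - k) \<tau> \<tau>') - v))\<^sup>2"
    and Z: "partition_fun F N \<le> C * exp (real N * g)" and C: "0 < C"
  shows "exp K / (2 * C) * prodw k v \<tau> \<le> marginal_weight F N k \<tau>"
proof -
  let ?a = "append_config k (N - k) \<tau>"
  have bound: "exp (real N * g + K) * (prodw k v \<tau> * prodw (N - k) v \<tau>') \<le> exp (real N * F (emp N (?a \<tau>')))"
    if \<tau>': "\<tau>' \<in> typical (N - k) v" for \<tau>'
  proof -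
    define m where "m = emp N (?a \<tau>')"
    have counts: "counts N (?a \<tau>') = counts k \<tau> + counts (N - k) \<tau>'"
      using counts_append_config[of k "N - k" \<tau> \<tau>'] N by simp
    have "real N * (\<Sum>c\<in>UNIV. m $ c * ln (v $ c)) = (\<Sum>c\<in>UNIV. counts N (?a \<tau>') $ c * ln (v $ c))"
      by (simp add: m_def counts_eq_emp sum_distrib_left mult.assoc)
    also have "\<dots> = (\<Sum>c\<in>UNIV. counts k \<tau> $ c * ln (v $ c)) + (\<Sum>c\<in>UNIV. counts (N - k) \<tau>' $ c * ln (v $ c))"
      by (simp add: counts distrib_right sum.distrib)
    finally have prod: "prodw k v \<tau> * prodw (N - k) v \<tau>' = exp (real N * (\<Sum>c\<in>UNIV. m $ c * ln (v $ c)))"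
      by (simp add: prodw_eq_exp[OF v(2)] exp_add)
    have "g + b * (norm (m - v))\<^sup>2 \<le> F m - (\<Sum>c\<in>UNIV. m $ c * ln (v $ c))"
      unfolding m_def by (intro b emp_in_simplex N near \<tau>')
    then have "real N * (g + b * (norm (m - v))\<^sup>2) \<le> real N * (F m - (\<Sum>c\<in>UNIV. m $ c * ln (v $ c)))"
      by (intro mult_left_mono) auto
    with away[OF \<tau>'] have "real N * g + K + real N * (\<Sum>c\<in>UNIV. m $ c * ln (v $ c)) \<le> real N * F m"
      by (simp add: m_def distrib_left right_diff_distrib mult.assoc)
    then show ?thesis unfolding prod m_def[symmetric] by (simp flip: exp_add)
  qed
  have "exp (real N * g + K) * (prodw k v \<tau> * (1 / 2))
      \<le> exp (real N * g + K) * (prodw k v \<tau> * (\<Sum>\<tau>'\<in>typical (N - k) v. prodw (N - k) v \<tau>'))"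
    by (intro mult_left_mono typical_weight prodw_nonneg v) auto
  also have "\<dots> \<le> (\<Sum>\<tau>'\<in>typical (N - k) v. exp (real N * F (emp N (?a \<tau>'))))"
    unfolding sum_distrib_left by (intro sum_mono bound)
  also have "\<dots> = (\<Sum>\<sigma>\<in>?a ` typical (N - k) v. exp (real N * F (emp N \<sigma>)))"
    by (subst sum.reindex[OF inj_on_subset[OF inj_on_append_config typical_subset]]) simp
  also have "\<dots> \<le> (\<Sum>\<sigma>\<in>{\<sigma>\<in>configs N. restrict \<sigma> {1..k} = \<tau>}. exp (real N * F (emp N \<sigma>)))"
  proof (rule sum_mono2)
    show "?a ` typical (N - k) v \<subseteq> {\<sigma>\<in>configs N. restrict \<sigma> {1..k} = \<tau>}"
      using append_config_in[of k "N - k" \<tau>] restrict_append_config[OF \<tau>] N by auto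
  qed auto
  finally have "exp (real N * g + K) * (prodw k v \<tau> * (1 / 2)) / partition_fun F N \<le> marginal_weight F N k \<tau>"
    unfolding marginal_weight_def using partition_fun_pos[of F N] by (intro divide_right_mono) auto
  moreover have "exp (real N * g + K) * (prodw k v \<tau> * (1 / 2)) / (C * exp (real N * g))
      \<le> exp (real N * g + K) * (prodw k v \<tau> * (1 / 2)) / partition_fun F N"
    using Z C partition_fun_pos[of F N] prodw_nonneg[OF v(1), of k \<tau>]
    by (intro divide_left_mono mult_nonneg_nonneg mult_pos_pos) auto
  moreover have "exp (real N * g + K) * (prodw k v \<tau> * (1 / 2)) / (C * exp (real N * g))
      = exp K / (2 * C) * prodw k v \<tau>"
    by (simp add: exp_add)
  ultimately show ?thesis by linarith
qed

lemma typical_distance: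
  fixes v d :: "real ^ 'c::finite"
  assumes "\<tau> \<in> typical k (v + (1 / sqrt (real k)) *\<^sub>R d)" "0 < k"
  shows "sqrt (real k) * (norm d - sqrt 2) \<le> norm (counts k \<tau> - real k *\<^sub>R v)"
    "norm (counts k \<tau> - real k *\<^sub>R v) \<le> sqrt (real k) * (norm d + sqrt 2)"
proof -
  define e where "e = counts k \<tau> - real k *\<^sub>R (v + (1 / sqrt (real k)) *\<^sub>R d)"
  have "(norm e)\<^sup>2 \<le> 2 * real k" using assms(1) by (simp add: typical_def e_def)
  then have e: "norm e \<le> sqrt 2 * sqrt (real k)" unfolding real_sqrt_mult[symmetric] by (rule real_le_rsqrt)
  have "real k * (1 / sqrt (real k)) = sqrt (real k)" using assms(2) by (simp add: real_div_sqrt)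
  then have eq: "counts k \<tau> - real k *\<^sub>R v = e + sqrt (real k) *\<^sub>R d"
    by (simp add: e_def scaleR_add_right)
  have d: "norm (sqrt (real k) *\<^sub>R d) = sqrt (real k) * norm d" by simp
  show "norm (counts k \<tau> - real k *\<^sub>R v) \<le> sqrt (real k) * (norm d + sqrt 2)"
    using norm_triangle_ineq[of e "sqrt (real k) *\<^sub>R d"] e unfolding eq d by (simp add: algebra_simps)
  have "norm (sqrt (real k) *\<^sub>R d) \<le> norm (e + sqrt (real k) *\<^sub>R d) + norm e"
    using norm_triangle_ineq4[of "e + sqrt (real k) *\<^sub>R d" e] by simp
  then show "sqrt (real k) * (norm d - sqrt 2) \<le> norm (counts k \<tau> - real k *\<^sub>R v)"
    using e unfolding eq d by (simp add: algebra_simps)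
qed

lemma norm_emp_diff:
  assumes "0 < N"
  shows "norm (emp N \<sigma> - v) = norm (counts N \<sigma> - real N *\<^sub>R v) / real N"
proof -
  have "counts N \<sigma> - real N *\<^sub>R v = real N *\<^sub>R (emp N \<sigma> - v)"
    by (simp add: counts_eq_emp scaleR_diff_right)
  then show ?thesis using assms by simp
qed

lemma sum_zero_vector_of_norm:
  assumes "0 \<le> (s::real)"
  obtains d :: "real ^ 'n::finite option" where "(\<Sum>c\<in>UNIV. d $ c) = 0" "norm d = s"
proof
  let ?t = "tangent (\<lambda>_. 1) :: real ^ 'n option"
  have "?t \<noteq> 0" by (simp add: vec_eq_iff tangent_def split: option.split)
  then show "norm ((s / norm ?t) *\<^sub>R ?t) = s" using assms by simp
  show "(\<Sum>c\<in>UNIV. ((s / norm ?t) *\<^sub>R ?t) $ c) = 0"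
    using sum_tangent[of "\<lambda>_ :: 'n. 1"] by (simp flip: sum_distrib_left sum_divide_distrib)
qed

text \<open>\<open>assumption_A\<close> alone leaves room for \<open>p = 0\<close>. A maximizer
  exists by compactness, which yields \<open>M 1\<close> as reference point.\<close>

lemma maximizers_nonempty:
  fixes F :: "real ^ ('n::finite option) \<Rightarrow> real"
  assumes C2: "C2_on prob_simplex F"
  shows "maximizers (free_energy F) \<noteq> {}"
proof -
  have "(0 :: real ^ 'n) \<in> red_simplex" by (simp add: red_simplex_def)
  then have ne: "prob_simplex \<noteq> ({} :: (real ^ 'n option) set)" using lift_in_simplex by blast
  have "continuous_on prob_simplex (\<lambda>m. F m + ent m)"
    by (intro continuous_on_add continuous_on_C2[OF C2] continuous_on_ent)
  from continuous_attains_sup[OF compact_prob_simplex ne this]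
  obtain m where m: "m \<in> prob_simplex" "\<And>m'. m' \<in> prob_simplex \<Longrightarrow> F m' + ent m' \<le> F m + ent m" by blast
  then have "(\<chi> i. m $ Some i) \<in> maximizers (free_energy F)"
    using lift_reduce[OF m(1)] by (auto simp: maximizers_def free_energy_def intro: lift_in_simplex)
  then show ?thesis by blast
qed

text \<open>Makes the constant \<open>2 * ln 2 - 1\<close> positive.\<close>

lemma ln_2_gt_half: "1 / 2 < ln (2::real)"
proof -
  have "ln (1 / 2 :: real) \<le> 1 / 2 - 1" by (rule ln_le_minus_one) simp
  moreover have "ln (1 / 2 :: real) \<noteq> 1 / 2 - 1" using ln_eq_minus_one[of "1 / 2 :: real"] by auto
  ultimately show ?thesis by (simp add: ln_div)
qed

text \<open>\<open>powr\<close> is positive at every nonzero base, so it is enough that determinant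
  and product do not vanish.\<close>

lemma weight_pos:
  assumes "pos_def (H_mat F x)" "\<And>c. 0 < lift x $ c"
  shows "0 < weight F x"
proof -
  have "det (H_mat F x) \<noteq> 0" using pos_def_invertible[OF assms(1)] by (simp add: invertible_det_nz)
  moreover have "(\<Prod>c\<in>UNIV. lift x $ c) \<noteq> 0" using assms(2) by (simp add: prod_zero_iff) (metis less_irrefl)
  ultimately show ?thesis by (simp add: weight_def)
qed

lemma rho_eq:
  "rho F p M k = point_measure (configs k) (\<lambda>\<sigma>. ennreal
     (\<Sum>j=1..p. weight F (M j) / (\<Sum>j=1..p. weight F (M j)) * prodw k (lift (M j)) \<sigma>))"
proof -
  have "(\<Sum>l\<in>UNIV. lift x $ l * of_bool (c = l)) = lift x $ c" for x :: "real ^ 'a" and c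
    by (simp add: of_bool_def if_distrib cong: if_cong)
  then show ?thesis by (simp add: rho_def prodw_def sum_distrib_left mult_ac)
qed

theorem corollary3p3:
  fixes F :: "real ^ ('n::finite option) \<Rightarrow> real"
    and M :: "nat \<Rightarrow> real ^ 'n" and p :: nat
    and k :: "nat \<Rightarrow> nat" and \<alpha> :: real
  assumes "C2_on prob_simplex F"
    and "assumption_A F p M"
    and "assumption_B F p M"
    and "\<forall>j\<in>{1..p}. pos_def (Sigma_mat F (M j))"
    and "\<forall>N\<ge>1. 1 \<le> k N \<and> k N \<le> N"
    and "(\<lambda>N. real (k N) / real N) \<longlonglongrightarrow> \<alpha>"
    and "0 < \<alpha>" and "\<alpha> \<le> 1"
  shows "liminf (\<lambda>N. rel_entropy (gibbs_marginal F N (k N)) (rho F p M (k N))) > 0"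
proof -
  let ?G = "free_energy F"
  define V where "V = (\<lambda>j. lift (M j)) ` {1..p}"
  have bij: "bij_betw M {1..p} (maximizers ?G)" and int: "\<And>j. j \<in> {1..p} \<Longrightarrow> M j \<in> interior red_simplex"
    using assms(2) by (auto simp: assumption_A_def)
  have max: "M j \<in> maximizers ?G" if "j \<in> {1..p}" for j using bij that by (auto simp: bij_betw_def)
  have H: "pos_def (H_mat F (M j))" if "j \<in> {1..p}" for j using assms(3) that by (simp add: assumption_B_def)
  have pos: "0 < lift (M j) $ c" if "j \<in> {1..p}" for j c using interior_lift_pos[OF int[OF that]] .
  have simplex: "lift (M j) \<in> prob_simplex" if "j \<in> {1..p}" for j
    using int[OF that] interior_subset by (intro lift_in_simplex) auto
  have one: "1 \<in> {1..p}"
    using maximizers_nonempty[OF assms(1)] bij by (auto simp: bij_betw_def intro: ccontr)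
  define v where "v = lift (M 1)"
  define g where "g = ?G (M 1)"
  have v: "v \<in> prob_simplex" "\<And>c. 0 < v $ c" using simplex[OF one] pos[OF one] by (auto simp: v_def)
  have g: "?G (M j) = g" if "j \<in> {1..p}" for j
    using max[OF that] max[OF one] by (auto simp: maximizers_def g_def intro: antisym)

  obtain C where C: "0 < C" "\<forall>\<^sub>F N in sequentially. partition_fun F N \<le> C * exp (real N * g)"
  proof -
    have "\<exists>C>0. \<forall>\<^sub>F N in sequentially. partition_fun F N \<le> C * exp (real N * g)"
    proof (rule partition_fun_bound)
      show "finite V" "V \<subseteq> prob_simplex" "\<And>w c. w \<in> V \<Longrightarrow> 0 < w $ c"
        using simplex pos by (auto simp: V_def)
      fix w assume "w \<in> V"
      then obtain j where j: "j \<in> {1..p}" "w = lift (M j)" by (auto simp: V_def)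
      show "\<exists>c>0. \<exists>\<delta>>0. \<forall>m\<in>prob_simplex. norm (m - w) \<le> \<delta> \<longrightarrow> F m + ent m \<le> g - c * (norm (m - w))\<^sup>2"
        using free_energy_upper[OF assms(1) int[OF j(1)] max[OF j(1)] H[OF j(1)]]
        unfolding g[OF j(1)] j(2) .
    next
      fix U assume U: "open U" "V \<subseteq> U"
      have "maximizers ?G = M ` {1..p}" using bij by (simp add: bij_betw_def)
      then have "lift ` maximizers ?G = V" by (simp add: V_def image_image)
      with U free_energy_gap[OF assms(1) max[OF one], of U]
      show "\<exists>\<eta>>0. \<forall>m\<in>prob_simplex - U. F m + ent m \<le> g - \<eta>" by (simp add: g_def)
    qed
    then show ?thesis using that by blast
  qed
  obtain b \<delta> where b: "0 < b" and \<delta>: "0 < \<delta>" and lower: "\<And>m. m \<in> prob_simplex \<Longrightarrow> norm (m - v) \<le> \<delta> \<Longrightarrow>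
      g + b * (norm (m - v))\<^sup>2 \<le> F m - (\<Sum>c\<in>UNIV. m $ c * ln (v $ c))"
    using free_energy_lower[OF assms(1) int[OF one] max[OF one] H[OF one]] assms(4) one
    unfolding v_def g_def by blast
  have "\<exists>\<delta>>0. \<forall>N \<sigma>. norm (emp N \<sigma> - v) < \<delta> \<longrightarrow> prodw N (lift (M j)) \<sigma> \<le> prodw N v \<sigma>"
    if j: "j \<in> {1..p}" for j
  proof (cases "lift (M j) = v")
    case True
    then show ?thesis by (intro exI[of _ 1]) simp
  next
    case False
    then show ?thesis by (intro prodw_le_near v simplex[OF j] pos[OF j])
  qed
  then obtain \<epsilon> where \<epsilon>: "\<And>j. j \<in> {1..p} \<Longrightarrow> 0 < \<epsilon> j"
      "\<And>j N \<sigma>. j \<in> {1..p} \<Longrightarrow> norm (emp N \<sigma> - v) < \<epsilon> j \<Longrightarrow> prodw N (lift (M j)) \<sigma> \<le> prodw N v \<sigma>"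
    by metis

  text \<open>The deviation \<open>s / sqrt k\<close> from \<open>v\<close> is chosen so large that the convexity of the tilt
    beats the constant \<open>C\<close>.\<close>

  define K where "K = ln (4 * C)"
  \<comment> \<open>\<open>K\<close> makes \<open>exp K / (2 * C)\<close> equal to 2. For large
    \<open>N\<close>, \<open>a\<close> is a lower bound for \<open>sqrt (k / N)\<close>;
    \<open>r\<close> is the displacement, in units of 1 / sqrt N, at which the quadratic gain
    reaches \<open>K\<close>. In \<open>s\<close>, one \<open>sqrt 2\<close> covers the fluctuation
    of the first \<open>k\<close> colours around the shifted centre, the other that of the remaining
    ones.\<close>
  define a where "a = sqrt (\<alpha> / 2)"
  define r where "r = sqrt (\<bar>K\<bar> / b)"
  define s where "s = sqrt 2 + (r + sqrt 2) / a"
  have a: "0 < a" using assms(7) by (simp add: a_def)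
  have r: "0 \<le> r" "K \<le> b * r\<^sup>2" using b by (simp_all add: r_def)
  have s: "sqrt 2 \<le> s" "a * (s - sqrt 2) = r + sqrt 2" using a r by (simp_all add: s_def)
  then have "0 \<le> s" by (meson order_trans real_sqrt_ge_zero zero_le_numeral)
  then obtain d :: "real ^ 'n option" where d: "(\<Sum>c\<in>UNIV. d $ c) = 0" "norm d = s"
    using sum_zero_vector_of_norm by blast
  define E where "E k = typical k (v + (1 / sqrt (real k)) *\<^sub>R d)" for k
  obtain \<kappa> where \<kappa>: "0 < \<kappa>" "\<forall>\<^sub>F k in sequentially. \<kappa> \<le> (\<Sum>\<sigma>\<in>E k. prodw k v \<sigma>)"
    using typical_shifted_weight[OF v d(1)] unfolding E_def by blast

  define W where "W = (\<Sum>j=1..p. weight F (M j))"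
  have wpos: "0 < weight F (M j)" if "j \<in> {1..p}" for j by (rule weight_pos[OF H[OF that] pos[OF that]])
  have W: "0 < W" unfolding W_def using one by (intro sum_pos wpos) auto
  define f where "f k \<sigma> = (\<Sum>j=1..p. weight F (M j) / W * prodw k (lift (M j)) \<sigma>)" for k \<sigma>
  have Wsum: "(\<Sum>j=1..p. weight F (M j) / W) = 1"
    using W by (simp add: W_def flip: sum_divide_distrib)
  have fpos: "0 < f k \<sigma>" for k \<sigma>
    unfolding f_def using one wpos W pos
    by (intro sum_pos mult_pos_pos divide_pos_pos) (auto simp: prodw_def intro!: prod_pos)
  have fsum: "(\<Sum>\<sigma>\<in>configs k. f k \<sigma>) = 1" for k
  proof -
    have "(\<Sum>\<sigma>\<in>configs k. f k \<sigma>) = (\<Sum>j=1..p. weight F (M j) / W * (\<Sum>\<sigma>\<in>configs k. prodw k (lift (M j)) \<sigma>))"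
      unfolding f_def sum_distrib_left by (rule sum.swap)
    also have "\<dots> = (\<Sum>j=1..p. weight F (M j) / W)"
      by (intro sum.cong refl) (simp add: prodw_total simplex)
    finally show ?thesis using Wsum by simp
  qed
  have fE: "weight F (M 1) / W * (\<Sum>\<sigma>\<in>E k. prodw k v \<sigma>) \<le> sum (f k) (E k)" for k
    unfolding sum_distrib_left
  proof (intro sum_mono)
    fix \<sigma>
    show "weight F (M 1) / W * prodw k v \<sigma> \<le> f k \<sigma>"
      unfolding f_def v_def using wpos W simplex one
      by (intro member_le_sum[of 1 "{1..p}" "\<lambda>j. weight F (M j) / W * prodw k (lift (M j)) \<sigma>"]
          mult_nonneg_nonneg divide_nonneg_nonneg prodw_nonneg) (auto simp: less_imp_le)
  qed

  have kN: "\<forall>\<^sub>F N in sequentially. 1 \<le> k N \<and> k N \<le> N"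
    using assms(5) unfolding eventually_at_top_linorder by blast
  have "\<forall>\<^sub>F N in sequentially. \<alpha> / 2 < real (k N) / real N"
    using assms(6,7) by (intro order_tendstoD(1)) auto
  then have ratio: "\<forall>\<^sub>F N in sequentially. \<alpha> / 2 * real N \<le> real (k N)"
    using eventually_gt_at_top[of 0] by eventually_elim (simp add: field_simps)
  have "filterlim (\<lambda>N. real (k N)) at_top sequentially"
  proof (rule filterlim_at_top_mono[OF _ ratio])
    show "filterlim (\<lambda>N. \<alpha> / 2 * real N) at_top sequentially" using assms(7) by real_asymp
  qed
  \<comment> \<open>This transfers statements about all large \<open>k\<close> to \<open>k N\<close>
    for all large \<open>N\<close>.\<close>
  then have klim: "filterlim k sequentially sequentially"
    by (simp add: filterlim_sequentially_iff_filterlim_real)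
  have \<kappa>N: "\<forall>\<^sub>F N in sequentially. \<kappa> \<le> (\<Sum>\<sigma>\<in>E (k N). prodw (k N) v \<sigma>)"
    using \<kappa>(2) klim by (rule eventually_compose_filterlim)
  have small: "\<forall>\<^sub>F N in sequentially. x / sqrt (real N) < y" if "0 < y" for x y :: real
  proof -
    have "(\<lambda>N. x / sqrt (real N)) \<longlonglongrightarrow> 0" by real_asymp
    from order_tendstoD(2)[OF this that] show ?thesis .
  qed
  have smallk: "\<forall>\<^sub>F N in sequentially. \<forall>j\<in>{1..p}. (s + sqrt 2) / sqrt (real (k N)) < \<epsilon> j"
    using eventually_compose_filterlim[OF small klim] \<epsilon>(1) by (intro eventually_ball_finite) auto

  define c where "c = (2 * ln 2 - 1) * (weight F (M 1) / W * \<kappa>)"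
  have c: "0 < c" using ln_2_gt_half wpos[OF one] W \<kappa>(1) by (simp add: c_def)
  have "\<forall>\<^sub>F N in sequentially. ereal c \<le> rel_entropy (gibbs_marginal F N (k N)) (rho F p M (k N))"
    using C(2) kN ratio \<kappa>N small[OF \<delta>, of "s + 2 * sqrt 2"] smallk
  proof eventually_elim
    case (elim N)
    have N: "1 \<le> N" "k N \<le> N" "0 < k N" using elim(2) by auto
    let ?k = "k N"
    have sk: "a * sqrt (real N) \<le> sqrt (real ?k)" "sqrt (real ?k) \<le> sqrt (real N)"
      using elim(3) N unfolding a_def real_sqrt_mult[symmetric] by auto
    have two: "2 * f ?k \<tau> \<le> marginal_weight F N ?k \<tau>" if \<tau>: "\<tau> \<in> E ?k" for \<tau>
    proof -
      have \<tau>c: "\<tau> \<in> configs ?k" using \<tau> typical_subset by (auto simp: E_def)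
      note dist = typical_distance[OF \<tau>[unfolded E_def] N(3), unfolded d(2)]
      have "norm (emp ?k \<tau> - v) \<le> sqrt (real ?k) * (s + sqrt 2) / real ?k"
        unfolding norm_emp_diff[OF N(3)] using dist(2) by (intro divide_right_mono) auto
      also have "\<dots> = (s + sqrt 2) / sqrt (real ?k)"
        using N by (simp add: field_simps)
      finally have emp: "norm (emp ?k \<tau> - v) \<le> (s + sqrt 2) / sqrt (real ?k)" .
      have "f ?k \<tau> \<le> (\<Sum>j=1..p. weight F (M j) / W * prodw ?k v \<tau>)"
        unfolding f_def
      proof (intro sum_mono mult_left_mono)
        fix j assume j: "j \<in> {1..p}"
        show "prodw ?k (lift (M j)) \<tau> \<le> prodw ?k v \<tau>"
          using elim(6) j emp by (intro \<epsilon>(2)[OF j]) force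
        show "0 \<le> weight F (M j) / W" using wpos[OF j] W by simp
      qed
      also have "\<dots> = prodw ?k v \<tau>" unfolding sum_distrib_right[symmetric] Wsum by simp
      finally have f_le: "f ?k \<tau> \<le> prodw ?k v \<tau>" .
      \<comment> \<open>The lower bound secures the gain \<open>K\<close>; the upper bound keeps the
        empirical measure in the ball where \<open>lower\<close> is available.\<close>
      have ap: "r * sqrt (real N) \<le> norm (counts N (append_config ?k (N - ?k) \<tau> \<tau>') - real N *\<^sub>R v)"
        "norm (counts N (append_config ?k (N - ?k) \<tau> \<tau>') - real N *\<^sub>R v) \<le> (s + 2 * sqrt 2) * sqrt (real N)"
        if \<tau>': "\<tau>' \<in> typical (N - ?k) v" for \<tau>'
      proof -
        have "(norm (counts (N - ?k) \<tau>' - real (N - ?k) *\<^sub>R v))\<^sup>2 \<le> 2 * real (N - ?k)"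
          using \<tau>' by (simp add: typical_def)
        then have "(norm (counts (N - ?k) \<tau>' - real (N - ?k) *\<^sub>R v))\<^sup>2 \<le> 2 * real N" by linarith
        then have n2: "norm (counts (N - ?k) \<tau>' - real (N - ?k) *\<^sub>R v) \<le> sqrt 2 * sqrt (real N)"
          unfolding real_sqrt_mult[symmetric] by (rule real_le_rsqrt)
        have "counts N (append_config ?k (N - ?k) \<tau> \<tau>') = counts ?k \<tau> + counts (N - ?k) \<tau>'"
          using counts_append_config[of ?k "N - ?k" \<tau> \<tau>'] N by simp
        then have eq: "counts N (append_config ?k (N - ?k) \<tau> \<tau>') - real N *\<^sub>R v
          = (counts ?k \<tau> - real ?k *\<^sub>R v) + (counts (N - ?k) \<tau>' - real (N - ?k) *\<^sub>R v)"
          using N by (simp add: of_nat_diff scaleR_diff_left)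
        have "(r + sqrt 2) * sqrt (real N) = (a * sqrt (real N)) * (s - sqrt 2)"
          unfolding s(2)[symmetric] by simp
        also have "\<dots> \<le> sqrt (real ?k) * (s - sqrt 2)" using sk s by (intro mult_right_mono) auto
        finally have "(r + sqrt 2) * sqrt (real N) \<le> norm (counts ?k \<tau> - real ?k *\<^sub>R v)"
          using dist(1) by linarith
        moreover have "norm (counts ?k \<tau> - real ?k *\<^sub>R v) - norm (counts (N - ?k) \<tau>' - real (N - ?k) *\<^sub>R v)
            \<le> norm (counts N (append_config ?k (N - ?k) \<tau> \<tau>') - real N *\<^sub>R v)"
          unfolding eq by (rule norm_diff_ineq)
        ultimately show "r * sqrt (real N) \<le> norm (counts N (append_config ?k (N - ?k) \<tau> \<tau>') - real N *\<^sub>R v)"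
          using n2 by (simp add: distrib_right)
        have "norm (counts N (append_config ?k (N - ?k) \<tau> \<tau>') - real N *\<^sub>R v)
            \<le> sqrt (real ?k) * (s + sqrt 2) + sqrt 2 * sqrt (real N)"
          unfolding eq using dist(2) n2 by (intro norm_triangle_le) linarith
        also have "sqrt (real ?k) * (s + sqrt 2) \<le> sqrt (real N) * (s + sqrt 2)"
          using sk \<open>0 \<le> s\<close> by (intro mult_right_mono) auto
        finally show "norm (counts N (append_config ?k (N - ?k) \<tau> \<tau>') - real N *\<^sub>R v) \<le> (s + 2 * sqrt 2) * sqrt (real N)"
          by (simp add: algebra_simps)
      qed
      have sqN: "0 < sqrt (real N)" "real N = sqrt (real N) * sqrt (real N)" using N by auto
      have "exp K / (2 * C) * prodw ?k v \<tau> \<le> marginal_weight F N ?k \<tau>"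
      proof (rule marginal_weight_lower[OF v N(1,2) \<tau>c lower _ _ elim(1) C(1)])
        fix \<tau>' assume \<tau>': "\<tau>' \<in> typical (N - ?k) v"
        let ?n = "norm (counts N (append_config ?k (N - ?k) \<tau> \<tau>') - real N *\<^sub>R v)"
        have n: "norm (emp N (append_config ?k (N - ?k) \<tau> \<tau>') - v) = ?n / real N"
          using N by (intro norm_emp_diff) simp
        have "?n / real N \<le> (s + 2 * sqrt 2) * sqrt (real N) / real N"
          using ap(2)[OF \<tau>'] by (intro divide_right_mono) auto
        also have "\<dots> = (s + 2 * sqrt 2) / sqrt (real N)"
          using N by (simp add: field_simps)
        finally show "norm (emp N (append_config ?k (N - ?k) \<tau> \<tau>') - v) \<le> \<delta>"
          unfolding n using elim(5) by linarith
        have "(r * sqrt (real N))\<^sup>2 \<le> ?n\<^sup>2" using ap(1)[OF \<tau>'] r(1) by (intro power_mono) auto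
        then have "b * r\<^sup>2 * real N \<le> b * ?n\<^sup>2"
          using b by (simp add: power_mult_distrib)
        then have "b * r\<^sup>2 \<le> b * ?n\<^sup>2 / real N" using N by (simp add: pos_le_divide_eq)
        also have "\<dots> = real N * b * (?n / real N)\<^sup>2" using N by (simp add: power2_eq_square)
        finally show "K \<le> real N * b * (norm (emp N (append_config ?k (N - ?k) \<tau> \<tau>') - v))\<^sup>2"
          unfolding n using r(2) by linarith
      qed
      moreover have "exp K / (2 * C) = 2" using C(1) by (simp add: K_def)
      ultimately show ?thesis using f_le by simp
    qed
    have "c \<le> (2 * ln 2 - 1) * sum (f ?k) (E ?k)"
      unfolding c_def
    proof (rule mult_left_mono)
      have "weight F (M 1) / W * \<kappa> \<le> weight F (M 1) / W * (\<Sum>\<sigma>\<in>E ?k. prodw ?k v \<sigma>)"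
        using elim(4) wpos[OF one] W by (intro mult_left_mono) auto
      also note fE
      finally show "weight F (M 1) / W * \<kappa> \<le> sum (f ?k) (E ?k)" .
    qed (use ln_2_gt_half in simp)
    then have "ereal c \<le> ereal ((2 * ln 2 - 1) * sum (f ?k) (E ?k))" by simp
    also have "\<dots> \<le> rel_entropy (gibbs_marginal F N ?k) (rho F p M ?k)"
      unfolding gibbs_marginal_eq[OF N(2)] rho_eq W_def[symmetric] f_def[symmetric]
    proof (rule rel_entropy_point_measure_ge)
      show "E ?k \<subseteq> configs ?k" by (simp add: E_def typical_subset)
    qed (simp_all add: fpos fsum two marginal_weight_nonneg sum_marginal_weight[OF N(2)])
    finally show ?case .
  qed
  then have "ereal c \<le> liminf (\<lambda>N. rel_entropy (gibbs_marginal F N (k N)) (rho F p M (k N)))"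
    by (rule Liminf_bounded)
  with c show ?thesis by (metis ereal_less(2) less_le_trans)
qed

end
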